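(* Let $r\ge1$, $s\ge2$, $\underline{x}=(x_1,\ldots,x_r)$, and let $P_1(\underline{x}),\ldots,P_s(\underline{x})\in\mathbb{Z}[\underline{x}]$ be nonzero coprime polynomials. Let $\mathcal{R}=\{\underline{n}\in\mathbb{Z}^r\mid \gcd(P_1(\underline{n}),\ldots,P_s(\underline{n}))=1\}$. Then the density $\mu(\mathcal{R})$ is given by $$\mu(\mathcal{R})=\prod_{p\text{ prime}}\left(1-\frac{c_p}{p^r}\right),$$ where $c_p=\#\{\underline{n}\in(\mathbb{Z}/p\mathbb{Z})^r\mid P_1(\underline{n})=0 \pmod p,\ldots,P_s(\underline{n})=0\pmod p\}$.
   Context: Polynomials $P_1,\ldots,P_s\in\mathbb{Z}[\underline{x}]$ are called coprime if no polynomial $D\in\mathbb{Q}[\underline{x}]$ with $\deg D>0$ divides all of them in $\mathbb{Q}[\underline{x}]$. The density of a subset $\mathcal{S}\subset\mathbb{Z}^r$ is $$\mu(\mathcal{S})=\lim_{B\to+\infty}\frac{\#(\mathcal{S}\cap\mathbb{B})}{\#\mathbb{B}},\qquad \mathbb{B}=\{0,1,\ldots,B-1\}^r$$ (so only points with nonnegative coordinates matter). The claim includes the existence of this limit. The product is the limit of the partial products over primes $p\le M$ as $M\to+\infty$; its value may be $0$. *)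

theory Defs
  imports
    Complex_Main
    "HOL-Library.FuncSet"
    "HOL-Library.Poly_Mapping"
    "HOL-Computational_Algebra.Primes"
    "HOL-Number_Theory.Cong"
begin

text \<open>
  A monomial is a finitely supported exponent function; the variables are indexed from \<open>0\<close>.
  The type has infinitely many variables: the ring in \<open>r\<close> variables is its subset \<open>mpolys r\<close>.
\<close>

type_synonym 'a mpoly = "(nat \<Rightarrow>\<^sub>0 nat) \<Rightarrow>\<^sub>0 'a"

definition mpolys :: "nat \<Rightarrow> 'a::zero mpoly set" where
  "mpolys r = {p. \<forall>m \<in> Poly_Mapping.keys p. Poly_Mapping.keys m \<subseteq> {..<r}}"

text \<open>The zero polynomial gets total degree \<open>0\<close>.\<close>

definition total_degree :: "'a::zero mpoly \<Rightarrow> nat" where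
  "total_degree p =
     Max (insert 0 ((\<lambda>m. \<Sum>i\<in>Poly_Mapping.keys m. Poly_Mapping.lookup m i) ` Poly_Mapping.keys p))"

definition eval_mpoly :: "'a::comm_semiring_1 mpoly \<Rightarrow> (nat \<Rightarrow> 'a) \<Rightarrow> 'a" where
  "eval_mpoly p x =
     (\<Sum>m\<in>Poly_Mapping.keys p.
        Poly_Mapping.lookup p m * (\<Prod>i\<in>Poly_Mapping.keys m. x i ^ Poly_Mapping.lookup m i))"

definition rat_mpoly :: "int mpoly \<Rightarrow> rat mpoly" where
  "rat_mpoly p = Poly_Mapping.map of_int p"

text \<open>Divisibility in \<open>\<rat>[x\<^sub>0, \<dots>, x\<^bsub>r-1\<^esub>]\<close>: the cofactor too has to lie in \<open>mpolys r\<close>.\<close>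

definition mpoly_dvd :: "nat \<Rightarrow> 'a::comm_semiring_0 mpoly \<Rightarrow> 'a mpoly \<Rightarrow> bool" where
  "mpoly_dvd r D p \<longleftrightarrow> (\<exists>Q \<in> mpolys r. p = D * Q)"

text \<open>Coprimality of the family \<open>P 0, \<dots>, P (s - 1)\<close>.\<close>

definition coprime_mpolys :: "nat \<Rightarrow> nat \<Rightarrow> (nat \<Rightarrow> int mpoly) \<Rightarrow> bool" where
  "coprime_mpolys r s P \<longleftrightarrow>
     \<not> (\<exists>D \<in> mpolys r. total_degree D > 0 \<and> (\<forall>i<s. mpoly_dvd r D (rat_mpoly (P i))))"

text \<open>A point of \<open>\<int>\<^sup>r\<close> is a function extensional on \<open>{..<r}\<close>.\<close>

definition int_points :: "nat \<Rightarrow> (nat \<Rightarrow> int) set" where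
  "int_points r = {..<r} \<rightarrow>\<^sub>E UNIV"

definition box :: "nat \<Rightarrow> nat \<Rightarrow> (nat \<Rightarrow> int) set" where
  "box r B = {..<r} \<rightarrow>\<^sub>E {0..<int B}"

text \<open>The density of \<open>S\<close> exists and equals \<open>d\<close>.\<close>

definition has_density :: "nat \<Rightarrow> (nat \<Rightarrow> int) set \<Rightarrow> real \<Rightarrow> bool" where
  "has_density r S d \<longleftrightarrow>
     (\<lambda>B. real (card (S \<inter> box r B)) / real (card (box r B))) \<longlonglongrightarrow> d"

definition coprime_value_points :: "nat \<Rightarrow> nat \<Rightarrow> (nat \<Rightarrow> int mpoly) \<Rightarrow> (nat \<Rightarrow> int) set" where
  "coprime_value_points r s P = {n \<in> int_points r. Gcd ((\<lambda>i. eval_mpoly (P i) n) ` {..<s}) = 1}"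

text \<open>\<open>(\<int>/p\<int>)\<^sup>r\<close> is represented by the tuples of least nonnegative residues, that is, by \<open>box r p\<close>.\<close>

definition num_common_zeros :: "nat \<Rightarrow> nat \<Rightarrow> (nat \<Rightarrow> int mpoly) \<Rightarrow> nat \<Rightarrow> nat" where
  "num_common_zeros r s P p =
     card {n \<in> box r p. \<forall>i<s. [eval_mpoly (P i) n = 0] (mod int p)}"

end

theory Submission
  imports Defs "HOL-Computational_Algebra.Polynomial"
begin

text \<open>
  The set of points at which no prime \<open>p \<le> M\<close> divides all values is periodic, and by the Chinese remainder
  theorem its density is the partial product up to \<open>M\<close>. What remains is to show that the points of the
  box of side \<open>B\<close> at which some prime \<open>p > M\<close> divides all values number \<open>O(B ^ r (1 / M + 1 / B))\<close>. This goes
  by induction on \<open>r\<close>. Elimination of the last variable gives a nonzero polynomial \<open>h\<close> in the first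
  \<open>r - 1\<close> variables that lies in the ideal of the family, and the coefficients with respect to the last
  variable form again a coprime family. If \<open>p\<close> divides all values at a point, then \<open>p\<close> divides the value
  of \<open>h\<close>, and unless \<open>p\<close> divides all the coefficients, the last coordinate lies in boundedly many classes
  modulo \<open>p\<close>. The primes \<open>p \<le> B\<close> contribute \<open>O(\<Sum> B ^ r / p ^ 2)\<close>, and only boundedly many primes \<open>p > B\<close>
  divide a nonzero value of \<open>h\<close>.
\<close>

subsection \<open>Polynomials over a factorial subring\<close>

text \<open>The obstacle is the range of primes beyond B. The values at points of the box grow like
  a power of B, and so do the primes that may divide them; even a bounded number of points for each
  prime is too much when summed over all of these. Elimination removes the problem because h is
  constant along the last coordinate: its few large prime divisors at a point serve the whole fiber
  above it. For primes between M and B the gain is a second factor 1 / p, one from h vanishing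
  modulo p and one from the last coordinate, without which the sum over p would not converge.
  Coprimality is assumed in the polynomial ring, whereas a Bezout relation exists only over the
  fraction field in the first variables. Factoriality and Gauss's lemma bridge the two, hence the
  ring theory at the start; pseudo-division takes the place of fraction fields. The error bound is
  uniform in M and B, so that B can tend to infinity for fixed M, and M afterwards.\<close>

text \<open>
  Induction on the number of variables changes the ring, so it cannot be an induction over type
  classes. All rings are therefore subrings \<open>A\<close> of one ambient domain, and divisibility is
  relative to \<open>A\<close>. Note that \<open>prime_in\<close> also holds for units and for \<open>0\<close>; a size function with
  \<open>N p > 0\<close> excludes the former.
\<close>

definition prime_in :: "'a::comm_ring_1 set \<Rightarrow> 'a \<Rightarrow> bool" where
  "prime_in A p \<longleftrightarrow> (\<forall>a\<in>A. \<forall>b\<in>A. \<forall>c\<in>A. a * b = p * c \<longrightarrow>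
     (\<exists>d\<in>A. a = p * d) \<or> (\<exists>d\<in>A. b = p * d))"

definition polys_over :: "'a::zero set \<Rightarrow> 'a poly set" where
  "polys_over A = {f. \<forall>k. coeff f k \<in> A}"

text \<open>Degree alone does not see constant factors such as the content. Over the rationals,
  iterating this through the variables gives the total degree of the lexicographically leading
  monomial, which is additive on products and vanishes only for constants.\<close>

definition poly_size :: "('a::zero \<Rightarrow> nat) \<Rightarrow> 'a poly \<Rightarrow> nat" where
  "poly_size N f = degree f + N (lead_coeff f)"

locale subring =
  fixes A :: "'a::idom set"
  assumes zero: "0 \<in> A" and one: "1 \<in> A"
    and add: "a \<in> A \<Longrightarrow> b \<in> A \<Longrightarrow> a + b \<in> A"
    and mult: "a \<in> A \<Longrightarrow> b \<in> A \<Longrightarrow> a * b \<in> A"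
    and uminus: "a \<in> A \<Longrightarrow> - a \<in> A"
begin

lemma diff: "a \<in> A \<Longrightarrow> b \<in> A \<Longrightarrow> a - b \<in> A"
  using add[of a "- b"] uminus[of b] by simp

lemma sum: "(\<And>i. i \<in> I \<Longrightarrow> f i \<in> A) \<Longrightarrow> sum f I \<in> A"
  by (induction I rule: infinite_finite_induct) (auto intro: zero add)

lemma power: "a \<in> A \<Longrightarrow> a ^ n \<in> A"
  by (induction n) (auto intro: one mult)

lemma const_in_polys [simp]: "[:a:] \<in> polys_over A \<longleftrightarrow> a \<in> A"
  using zero by (auto simp: polys_over_def coeff_pCons split: nat.splits)

lemma monom_in_polys: "a \<in> A \<Longrightarrow> monom a n \<in> polys_over A"
  using zero by (auto simp: polys_over_def)

lemma subring_polys_over: "subring (polys_over A)"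
proof
  show "0 \<in> polys_over A" "1 \<in> polys_over A"
    using zero one by (auto simp: polys_over_def coeff_1 simp flip: one_poly_def)
next
  fix f g assume "f \<in> polys_over A" "g \<in> polys_over A"
  then show "f + g \<in> polys_over A" "f * g \<in> polys_over A"
    using add mult by (auto simp: polys_over_def coeff_mult intro: sum)
next
  fix f assume "f \<in> polys_over A"
  then show "- f \<in> polys_over A" using uminus by (auto simp: polys_over_def)
qed

interpretation polys: subring "polys_over A" by (rule subring_polys_over)

lemma lead_coeff_in: "f \<in> polys_over A \<Longrightarrow> lead_coeff f \<in> A"
  by (auto simp: polys_over_def)

lemma divisible_coeffs:
  assumes "\<And>k. \<exists>d\<in>A. coeff f k = p * d"
  shows "\<exists>h\<in>polys_over A. f = [:p:] * h"
  using assms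
proof (induction f rule: pCons_induct)
  case 0
  show ?case using polys.zero by (intro bexI[of _ 0]) auto
next
  case (pCons a f)
  have "\<exists>d\<in>A. coeff f k = p * d" for k
    using pCons.prems[of "Suc k"] by simp
  with pCons.IH obtain h where h: "h \<in> polys_over A" "f = [:p:] * h" by blast
  obtain d where d: "d \<in> A" "a = p * d" using pCons.prems[of 0] by auto
  have "pCons d h \<in> polys_over A"
    using h d by (auto simp: polys_over_def coeff_pCons split: nat.splits)
  then show ?case using h d by (intro bexI[of _ "pCons d h"]) auto
qed

text \<open>Gauss's lemma. If \<open>p\<close> divides neither factor, take in each the lowest
  coefficient not divisible by \<open>p\<close>, at \<open>i\<close> and \<open>j\<close>. In
  coefficient \<open>i + j\<close> of the product every other term contains an earlier coefficient
  and is divisible by \<open>p\<close>, so the product of these two would be as well.\<close>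

lemma prime_in_polys:
  assumes p: "p \<in> A" "prime_in A p"
  shows "prime_in (polys_over A) [:p:]"
  unfolding prime_in_def
proof (intro ballI impI)
  fix f g h assume fgh: "f \<in> polys_over A" "g \<in> polys_over A" "h \<in> polys_over A"
    and eq: "f * g = [:p:] * h"
  define D where "D = {p * d | d. d \<in> A}"
  have D_sum: "sum u I \<in> D" if "\<And>i. i \<in> I \<Longrightarrow> u i \<in> D" for u :: "nat \<Rightarrow> 'a" and I
    using that
  proof (induction I rule: infinite_finite_induct)
    case (insert i I)
    then obtain a b where "a \<in> A" "b \<in> A" "u i = p * a" "sum u I = p * b"
      unfolding D_def by blast
    then have "sum u (insert i I) = p * (a + b)" "a + b \<in> A"
      using insert add by (auto simp: algebra_simps)
    then show ?case by (auto simp: D_def)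
  qed (use zero in \<open>auto simp: D_def\<close>)
  have D_mult: "a * b \<in> D" "b * a \<in> D" if aD: "a \<in> D" and b: "b \<in> A" for a b
  proof -
    obtain d where "d \<in> A" "a = p * d" using aD by (auto simp: D_def)
    then have "a * b = p * (d * b)" "b * a = p * (d * b)" "d * b \<in> A"
      using b mult by (auto simp: mult_ac)
    then show "a * b \<in> D" "b * a \<in> D" unfolding D_def by blast+
  qed
  show "(\<exists>d\<in>polys_over A. f = [:p:] * d) \<or> (\<exists>d\<in>polys_over A. g = [:p:] * d)"
  proof (rule ccontr)
    assume neg: "\<not> ?thesis"
    have "\<exists>k. coeff f k \<notin> D"
      using divisible_coeffs[of f p] neg unfolding D_def by blast
    moreover have "\<exists>k. coeff g k \<notin> D"
      using divisible_coeffs[of g p] neg unfolding D_def by blast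
    ultimately obtain i j where i: "coeff f i \<notin> D" "\<And>k. k < i \<Longrightarrow> coeff f k \<in> D"
      and j: "coeff g j \<notin> D" "\<And>k. k < j \<Longrightarrow> coeff g k \<in> D"
      using exists_least_iff[of "\<lambda>k. coeff f k \<notin> D"] exists_least_iff[of "\<lambda>k. coeff g k \<notin> D"]
      by blast
    have fA: "coeff f k \<in> A" "coeff g k \<in> A" for k using fgh by (auto simp: polys_over_def)
    define R where "R = (\<Sum>k\<in>{..i+j} - {i}. coeff f k * coeff g (i + j - k))"
    have "R \<in> D" unfolding R_def
    proof (rule D_sum)
      fix k assume "k \<in> {..i+j} - {i}"
      then consider "k < i" | "i + j - k < j" by fastforce
      then show "coeff f k * coeff g (i + j - k) \<in> D"
        by cases (use i j fA D_mult in auto)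
    qed
    then obtain d where d: "d \<in> A" "R = p * d" by (auto simp: D_def)
    have "coeff (f * g) (i + j) = coeff f i * coeff g j + R"
      unfolding coeff_mult R_def by (subst sum.remove[of _ i]) auto
    moreover have "coeff (f * g) (i + j) = p * coeff h (i + j)" by (simp add: eq)
    ultimately have "coeff f i * coeff g j = p * (coeff h (i + j) - d)"
      using d by (simp add: algebra_simps)
    moreover have "coeff h (i + j) - d \<in> A" using fgh d by (auto simp: polys_over_def intro: diff)
    ultimately have "coeff f i \<in> D \<or> coeff g j \<in> D"
      using p fA unfolding prime_in_def D_def by blast
    then show False using i j by auto
  qed
qed

text \<open>Division by an element of least degree with coefficients kept in \<open>A\<close>:
  multiplying by \<open>lead_coeff d\<close> before cancelling the leading term replaces fractions.
  Remainders stay in the ideal \<open>J\<close>, so minimality of \<open>degree d\<close> rules out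
  any stop before 0.\<close>

lemma pseudo_multiple:
  assumes J: "J \<subseteq> polys_over A"
    and J_diff: "\<And>f g. f \<in> J \<Longrightarrow> g \<in> J \<Longrightarrow> f - g \<in> J"
    and J_mult: "\<And>f g. f \<in> J \<Longrightarrow> g \<in> polys_over A \<Longrightarrow> g * f \<in> J"
    and d: "d \<in> J" "d \<noteq> 0" and least: "\<And>f. f \<in> J \<Longrightarrow> f \<noteq> 0 \<Longrightarrow> degree d \<le> degree f"
    and f: "f \<in> J"
  shows "\<exists>l\<in>A. l \<noteq> 0 \<and> (\<exists>q\<in>polys_over A. d * q = [:l:] * f)"
  using f
proof (induction "degree f" arbitrary: f rule: less_induct)
  case less
  show ?case
  proof (cases "f = 0")
    case True
    then show ?thesis using one polys.zero by (intro bexI[of _ 1] conjI bexI[of _ 0]) auto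
  next
    case False
    define m where "m = monom (lead_coeff f) (degree f - degree d)"
    define g where "g = [:lead_coeff d:] * f - m * d"
    have A: "lead_coeff d \<in> A" "lead_coeff f \<in> A" "m \<in> polys_over A"
      using J d less.prems by (auto simp: m_def intro!: lead_coeff_in monom_in_polys)
    have gJ: "g \<in> J" unfolding g_def using A d less.prems by (intro J_diff J_mult) auto
    have deg: "degree d \<le> degree f" using least False less.prems by blast
    have dm: "degree m = degree f - degree d" "m \<noteq> 0"
      using False by (auto simp: m_def degree_monom_eq)
    have "\<exists>l\<in>A. l \<noteq> 0 \<and> (\<exists>q\<in>polys_over A. d * q = [:l:] * g)"
    proof (cases "g = 0")
      case True
      then show ?thesis using one polys.zero by (intro bexI[of _ 1] conjI bexI[of _ 0]) auto
    next
      case gn: False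
      have "degree g \<le> degree f" unfolding g_def
        by (rule degree_diff_le) (use degree_mult_le[of m d] dm deg in auto)
      moreover have "coeff g (degree f) = 0"
      proof -
        have "coeff (m * d) (degree m + degree d) = lead_coeff m * lead_coeff d"
          by (rule coeff_mult_degree_sum)
        then show ?thesis using dm deg by (simp add: g_def m_def)
      qed
      ultimately have "degree g < degree f"
        using gn by (metis le_neq_implies_less leading_coeff_0_iff)
      then show ?thesis using less.hyps gJ by blast
    qed
    then obtain l q where l: "l \<in> A" "l \<noteq> 0" "q \<in> polys_over A" "d * q = [:l:] * g" by blast
    have "d * (q + [:l:] * m) = [:l * lead_coeff d:] * f"
      using l by (simp add: g_def algebra_simps smult_diff_right)
    moreover have "q + [:l:] * m \<in> polys_over A" using l A by (intro polys.add polys.mult) auto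
    moreover have "l * lead_coeff d \<in> A" "l * lead_coeff d \<noteq> 0" using l A d mult by auto
    ultimately show ?thesis by blast
  qed
qed

end

text \<open>Unique factorization without gcds: as the factors are prime and not merely irreducible,
  their existence is enough, and \<open>N\<close> is the measure by which repeated extraction
  terminates.\<close>

locale factorial_subring = subring A for A :: "'a::idom set" +
  fixes N :: "'a \<Rightarrow> nat"
  assumes N_mult: "a \<in> A \<Longrightarrow> b \<in> A \<Longrightarrow> a \<noteq> 0 \<Longrightarrow> b \<noteq> 0 \<Longrightarrow> N (a * b) = N a + N b"
    and N_unit: "a \<in> A \<Longrightarrow> a \<noteq> 0 \<Longrightarrow> N a = 0 \<Longrightarrow> \<exists>b\<in>A. a * b = 1"
    and prime_factor: "a \<in> A \<Longrightarrow> a \<noteq> 0 \<Longrightarrow> N a > 0 \<Longrightarrow>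
      \<exists>p\<in>A. \<exists>b\<in>A. a = p * b \<and> N p > 0 \<and> prime_in A p"
begin

interpretation polys: subring "polys_over A" by (rule subring_polys_over)

abbreviation "psize \<equiv> poly_size N"

lemma size_mult:
  assumes "f \<in> polys_over A" "g \<in> polys_over A" "f \<noteq> 0" "g \<noteq> 0"
  shows "psize (f * g) = psize f + psize g"
  using assms N_mult[of "lead_coeff f" "lead_coeff g"] lead_coeff_in
  by (simp add: poly_size_def degree_mult_eq coeff_mult_degree_sum)

lemma size_const [simp]: "psize [:a:] = N a"
  by (simp add: poly_size_def)

lemma size_0_const:
  assumes "f \<in> polys_over A" "psize f = 0"
  obtains a where "a \<in> A" "f = [:a:]"
proof -
  have "degree f = 0" using assms by (simp add: poly_size_def)
  then obtain a where "f = [:a:]" by (auto elim: degree_eq_zeroE)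
  then show ?thesis using assms that by auto
qed

lemma size_unit:
  assumes "f \<in> polys_over A" "f \<noteq> 0" "psize f = 0"
  shows "\<exists>g\<in>polys_over A. f * g = 1"
proof -
  obtain a where a: "a \<in> A" "f = [:a:]" using size_0_const assms by blast
  then obtain b where "b \<in> A" "a * b = 1" using assms N_unit[of a] by auto
  then show ?thesis using a by (intro bexI[of _ "[:b:]"]) (auto simp: one_pCons mult.commute)
qed

text \<open>The scalar \<open>l\<close> is removed one prime factor at a time: by Gauss's lemma the
  prime divides \<open>u\<close> or \<open>q\<close>, and \<open>prim\<close> excludes
  \<open>u\<close>. Once \<open>N l = 0\<close>, what is left is a unit. The assumption
  \<open>prim\<close> expresses primitivity without a content.\<close>

lemma primitive_cancel:
  assumes u: "u \<in> polys_over A" "u \<noteq> 0"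
    and prim: "\<And>p h. p \<in> A \<Longrightarrow> N p > 0 \<Longrightarrow> prime_in A p \<Longrightarrow> h \<in> polys_over A \<Longrightarrow> u \<noteq> [:p:] * h"
    and "l \<in> A" "l \<noteq> 0" "f \<in> polys_over A" "q \<in> polys_over A" "u * q = [:l:] * f"
  shows "\<exists>q\<in>polys_over A. f = u * q"
  using assms(4-)
proof (induction "N l" arbitrary: l q rule: less_induct)
  case less
  show ?case
  proof (cases "N l = 0")
    case True
    then obtain b where b: "b \<in> A" "l * b = 1" using N_unit less.prems by blast
    have "[:b * l:] = 1" using b by (simp add: mult.commute one_pCons)
    then have "f = [:b * l:] * f" by (simp only: mult_1)
    also have "\<dots> = [:b:] * ([:l:] * f)" by (simp add: mult.commute)
    also have "\<dots> = u * ([:b:] * q)" by (simp only: less.prems(5)[symmetric] mult.left_commute)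
    finally have eq: "f = u * ([:b:] * q)" .
    have "[:b:] * q \<in> polys_over A" using b less.prems by (intro polys.mult) auto
    with eq show ?thesis by blast
  next
    case False
    then obtain p l' where p: "p \<in> A" "l' \<in> A" "l = p * l'" "N p > 0" "prime_in A p"
      using prime_factor[of l] less.prems by auto
    have nz: "p \<noteq> 0" "l' \<noteq> 0" using p less.prems by auto
    have eq: "u * q = [:p:] * ([:l':] * f)" using less.prems p by (simp add: mult.commute)
    have "[:l':] * f \<in> polys_over A" using p less.prems by (intro polys.mult) auto
    then have "(\<exists>d\<in>polys_over A. u = [:p:] * d) \<or> (\<exists>d\<in>polys_over A. q = [:p:] * d)"
      using prime_in_polys[OF p(1,5)] u less.prems eq unfolding prime_in_def by blast
    then obtain q' where q': "q' \<in> polys_over A" "q = [:p:] * q'"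
      using prim p by blast
    have "[:p:] * (u * q') = [:p:] * ([:l':] * f)"
      using eq q' by (metis mult.left_commute)
    then have "u * q' = [:l':] * f" using nz mult_cancel_left pCons_eq_0_iff by blast
    moreover have "N l' < N l" using p nz N_mult[of p l'] by simp
    ultimately show ?thesis using less.hyps[of l' q'] less.prems p nz q' by blast
  qed
qed

text \<open>
  The witness \<open>[:c:] * d\<close> has least degree in the ideal, and \<open>d\<close> is its primitive part: pseudo-division
  makes \<open>d\<close> a divisor of a scalar multiple of each member, and the scalar cancels by Gauss's lemma.
\<close>

lemma ideal_common_divisor:
  assumes J: "J \<subseteq> polys_over A"
    and J_diff: "\<And>f g. f \<in> J \<Longrightarrow> g \<in> J \<Longrightarrow> f - g \<in> J"
    and J_mult: "\<And>f g. f \<in> J \<Longrightarrow> g \<in> polys_over A \<Longrightarrow> g * f \<in> J"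
    and nonzero: "f0 \<in> J" "f0 \<noteq> 0"
  obtains c d where "c \<in> A" "c \<noteq> 0" "d \<in> polys_over A" "d \<noteq> 0" "[:c:] * d \<in> J"
    "\<And>f. f \<in> J \<Longrightarrow> \<exists>q\<in>polys_over A. f = d * q"
proof -
  obtain e where e: "e \<in> J" "e \<noteq> 0" "\<And>f. f \<in> J \<Longrightarrow> f \<noteq> 0 \<Longrightarrow> degree e \<le> degree f"
    using ex_has_least_nat[of "\<lambda>f. f \<in> J \<and> f \<noteq> 0" f0 degree] nonzero by blast
  let ?P = "\<lambda>d. d \<in> polys_over A \<and> (\<exists>c\<in>A. e = [:c:] * d)"
  have "?P e" using e J one by (auto intro!: bexI[of _ 1])
  then obtain d where d: "?P d" "\<And>d'. ?P d' \<Longrightarrow> psize d \<le> psize d'"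
    using ex_has_least_nat[of ?P e psize] by blast
  then obtain c where c: "c \<in> A" "e = [:c:] * d" by blast
  have nz: "c \<noteq> 0" "d \<noteq> 0" using c e by auto
  \<comment> \<open>A prime dividing \<open>d\<close> could be moved into \<open>c\<close>, leaving
    a cofactor of smaller size.\<close>
  have prim: "d \<noteq> [:p:] * h"
    if "p \<in> A" "N p > 0" "prime_in A p" "h \<in> polys_over A" for p h
  proof
    assume eq: "d = [:p:] * h"
    then have "?P h" using that c mult by (auto simp: mult.commute intro!: bexI[of _ "c * p"])
    moreover have "psize d = N p + psize h"
      using size_mult[of "[:p:]" h] that eq nz by auto
    ultimately show False using d(2)[of h] that by simp
  qed
  have "\<exists>q\<in>polys_over A. f = d * q" if f: "f \<in> J" for f
  proof -
    obtain l q where l: "l \<in> A" "l \<noteq> 0" "q \<in> polys_over A" "e * q = [:l:] * f"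
      using pseudo_multiple[OF J J_diff J_mult e(1,2) e(3) f] by blast
    have "d * ([:c:] * q) = [:l:] * f" using l c by (simp add: mult.left_commute)
    moreover have "[:c:] * q \<in> polys_over A" using c l by (intro polys.mult) auto
    ultimately show ?thesis using primitive_cancel[of d l f "[:c:] * q"] d nz prim l f J by blast
  qed
  then show ?thesis using that[of c d] c nz d e by blast
qed

text \<open>A divisor of least positive size is irreducible; the issue is to get a prime. A constant
  one has a prime factor in \<open>A\<close>. Otherwise \<open>p\<close> is primitive, and if it
  divides \<open>g * h\<close>, the common divisor of the ideal generated by \<open>p\<close> and
  \<open>g\<close> is either associated to \<open>p\<close>, so that \<open>p\<close> divides
  \<open>g\<close>, or constant, which yields a Bezout relation with a constant on the left.\<close>

lemma polys_prime_factor: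
  assumes f: "f \<in> polys_over A" "f \<noteq> 0" "psize f > 0"
  shows "\<exists>p\<in>polys_over A. \<exists>b\<in>polys_over A. f = p * b \<and> psize p > 0 \<and> prime_in (polys_over A) p"
proof -
  let ?P = "\<lambda>p. p \<in> polys_over A \<and> psize p > 0 \<and> (\<exists>b\<in>polys_over A. f = p * b)"
  have "?P f" using f polys.one by (auto intro!: bexI[of _ 1])
  then obtain p where p: "?P p" "\<And>p'. ?P p' \<Longrightarrow> psize p \<le> psize p'"
    using ex_has_least_nat[of ?P f psize] by blast
  then obtain b where b: "b \<in> polys_over A" "f = p * b" by blast
  have p0: "p \<noteq> 0" using b f by auto
  have irred: "psize v = 0" if "u \<in> polys_over A" "v \<in> polys_over A" "p = u * v" "psize u > 0" for u v
  proof -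
    have "?P u" using that b polys.mult[of v b] by (auto simp: mult.assoc)
    moreover have "psize p = psize u + psize v" using that p0 by (auto intro: size_mult)
    ultimately show ?thesis using p(2)[of u] by simp
  qed
  show ?thesis
  proof (cases "degree p = 0")
    case True
    then obtain a where a: "p = [:a:]" by (auto elim: degree_eq_zeroE)
    then obtain q c where q: "q \<in> A" "c \<in> A" "a = q * c" "N q > 0" "prime_in A q"
      using prime_factor[of a] p p0 by auto
    have "f = [:q:] * ([:c:] * b)" using q a b by (simp add: mult.commute)
    moreover have "[:c:] * b \<in> polys_over A" using q b by (intro polys.mult) auto
    ultimately show ?thesis using q prime_in_polys[of q] by (intro bexI[of _ "[:q:]"] bexI[of _ "[:c:] * b"]) auto
  next
    case False
    have prim: "p \<noteq> [:q:] * h" if "q \<in> A" "N q > 0" "h \<in> polys_over A" for q h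
    proof
      assume eq: "p = [:q:] * h"
      then have "psize h = 0" using irred[of "[:q:]" h] that by auto
      then have "degree h = 0" by (simp add: poly_size_def)
      then show False using False eq by (simp split: if_splits)
    qed
    have "prime_in (polys_over A) p" unfolding prime_in_def
    proof (intro ballI impI)
      fix g h k assume ghk: "g \<in> polys_over A" "h \<in> polys_over A" "k \<in> polys_over A" "g * h = p * k"
      define J where "J = {x * p + y * g | x y. x \<in> polys_over A \<and> y \<in> polys_over A}"
      have J: "J \<subseteq> polys_over A" using p ghk by (auto simp: J_def intro!: polys.add polys.mult)
      have J_diff: "u - v \<in> J" if "u \<in> J" "v \<in> J" for u v
      proof -
        from that obtain x y x' y' where *: "x \<in> polys_over A" "y \<in> polys_over A"
          "x' \<in> polys_over A" "y' \<in> polys_over A" "u = x * p + y * g" "v = x' * p + y' * g"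
          by (auto simp: J_def)
        then have "u - v = (x - x') * p + (y - y') * g" by (simp add: algebra_simps)
        then show ?thesis unfolding J_def using * polys.diff by blast
      qed
      have J_mult: "v * u \<in> J" if "u \<in> J" "v \<in> polys_over A" for u v
      proof -
        from that obtain x y where *: "x \<in> polys_over A" "y \<in> polys_over A" "u = x * p + y * g"
          by (auto simp: J_def)
        then have "v * u = (v * x) * p + (v * y) * g" by (simp add: algebra_simps)
        then show ?thesis unfolding J_def using * that polys.mult by blast
      qed
      have pJ: "p \<in> J" and gJ: "g \<in> J"
        using polys.zero polys.one by (force simp: J_def)+
      obtain c d where cd: "c \<in> A" "c \<noteq> 0" "d \<in> polys_over A" "d \<noteq> 0" "[:c:] * d \<in> J"
        and div: "\<And>f. f \<in> J \<Longrightarrow> \<exists>q\<in>polys_over A. f = d * q"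
        using ideal_common_divisor[OF J J_diff J_mult pJ p0] by blast
      obtain u where u: "u \<in> polys_over A" "p = d * u" using div pJ by blast
      obtain v where v: "v \<in> polys_over A" "g = d * v" using div gJ by blast
      show "(\<exists>d\<in>polys_over A. g = p * d) \<or> (\<exists>d\<in>polys_over A. h = p * d)"
      proof (cases "psize d = 0")
        case False
        then have "psize u = 0" using irred[of d u] u cd by auto
        then obtain w where w: "w \<in> polys_over A" "u * w = 1"
          using size_unit[of u] u p0 by auto
        have "g = d * (u * w) * v" using v w by simp
        also have "\<dots> = p * (w * v)" using u by (simp add: mult_ac)
        finally show ?thesis using w v polys.mult by blast
      next
        case True
        then obtain a where a: "a \<in> A" "d = [:a:]" using size_0_const cd by blast
        obtain x y where xy: "x \<in> polys_over A" "y \<in> polys_over A" "[:c * a:] = x * p + y * g"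
          using cd(5) a by (auto simp: J_def mult.commute)
        \<comment> \<open>Multiplying the Bezout relation by \<open>h\<close> makes \<open>p\<close>
          divide \<open>[:c * a:] * h\<close>; as \<open>p\<close> is primitive, the constant
          cancels.\<close>
        have "[:c * a:] * h = p * (x * h) + y * (g * h)" unfolding xy(3) by (simp add: algebra_simps)
        also have "\<dots> = p * (x * h + y * k)" using ghk by (simp add: algebra_simps)
        finally have "p * (x * h + y * k) = [:c * a:] * h" ..
        moreover have "x * h + y * k \<in> polys_over A" using xy ghk by (intro polys.add polys.mult) auto
        moreover have "c * a \<in> A" "c * a \<noteq> 0" using cd a mult by auto
        ultimately show ?thesis using primitive_cancel[of p "c * a" h] p p0 prim ghk by blast
      qed
    qed
    then show ?thesis using b p by blast
  qed
qed

lemma factorial_subring_polys_over: "factorial_subring (polys_over A) psize"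
  by unfold_locales (use size_mult size_unit polys_prime_factor in blast)+

end

text \<open>Injectivity is asked only on \<open>A\<close>: the intended map, evaluation at
  \<open>var r\<close>, kills the difference of the indeterminate and the constant
  \<open>var r\<close>, but it kills nothing except 0 among the polynomials with coefficients in
  \<open>mpolys r\<close>.\<close>

lemma (in factorial_subring) factorial_subring_image:
  fixes \<phi> :: "'a \<Rightarrow> 'b::idom"
  assumes hom: "\<phi> 0 = 0" "\<phi> 1 = 1" "\<And>a b. \<phi> (a + b) = \<phi> a + \<phi> b" "\<And>a b. \<phi> (a * b) = \<phi> a * \<phi> b"
    and inj: "\<And>a. a \<in> A \<Longrightarrow> \<phi> a = 0 \<Longrightarrow> a = 0"
  shows "factorial_subring (\<phi> ` A) (N \<circ> inv_into A \<phi>)"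
proof -
  have um: "\<phi> (- a) = - \<phi> a" for a
    using hom(3)[of a "- a"] hom(1) by (simp add: add_eq_0_iff)
  have inj': "inj_on \<phi> A"
  proof (rule inj_onI)
    fix a b assume "a \<in> A" "b \<in> A" "\<phi> a = \<phi> b"
    then have "\<phi> (a - b) = 0" using hom(3)[of a "- b"] um by simp
    then show "a = b" using inj[of "a - b"] diff \<open>a \<in> A\<close> \<open>b \<in> A\<close> by simp
  qed
  have inv [simp]: "inv_into A \<phi> (\<phi> a) = a" if "a \<in> A" for a using inj' that by simp
  have eqD: "a = b" if "\<phi> a = \<phi> b" "a \<in> A" "b \<in> A" for a b using inj' that by (auto dest: inj_onD)
  have prime: "prime_in (\<phi> ` A) (\<phi> p)" if p: "prime_in A p" "p \<in> A" for p
    unfolding prime_in_def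
  proof safe
    fix a b c assume "a \<in> A" "b \<in> A" "c \<in> A" "\<phi> a * \<phi> b = \<phi> p * \<phi> c"
      and nd: "\<not> (\<exists>d\<in>\<phi> ` A. \<phi> b = \<phi> p * d)"
    then have "a * b = p * c" using p by (intro eqD) (auto simp: hom intro: mult)
    then have "(\<exists>d\<in>A. a = p * d) \<or> (\<exists>d\<in>A. b = p * d)"
      using p \<open>a \<in> A\<close> \<open>b \<in> A\<close> \<open>c \<in> A\<close> by (auto simp: prime_in_def)
    then show "\<exists>d\<in>\<phi> ` A. \<phi> a = \<phi> p * d" using nd hom(4) by blast
  qed
  show ?thesis
  proof
    show "0 \<in> \<phi> ` A" using hom(1) zero by (metis image_eqI)
    show "1 \<in> \<phi> ` A" using hom(2) one by (metis image_eqI)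
  next
    fix a b assume "a \<in> \<phi> ` A" "b \<in> \<phi> ` A"
    then show "a + b \<in> \<phi> ` A" "a * b \<in> \<phi> ` A"
      using add mult by (auto simp flip: hom)
  next
    fix a assume "a \<in> \<phi> ` A"
    then show "- a \<in> \<phi> ` A" using uminus by (auto simp flip: um)
  next
    fix a b assume "a \<in> \<phi> ` A" "b \<in> \<phi> ` A" "a \<noteq> 0" "b \<noteq> 0"
    then show "(N \<circ> inv_into A \<phi>) (a * b) = (N \<circ> inv_into A \<phi>) a + (N \<circ> inv_into A \<phi>) b"
      using N_mult mult hom(1) by (fastforce simp flip: hom(4))
  next
    fix a assume "a \<in> \<phi> ` A" "a \<noteq> 0" "(N \<circ> inv_into A \<phi>) a = 0"
    then obtain a' where "a = \<phi> a'" "a' \<in> A" "a' \<noteq> 0" "N a' = 0" using hom(1) by fastforce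
    then show "\<exists>b\<in>\<phi> ` A. a * b = 1" using N_unit[of a'] hom(2) by (force simp flip: hom(4))
  next
    fix a assume "a \<in> \<phi> ` A" "a \<noteq> 0" "(N \<circ> inv_into A \<phi>) a > 0"
    then obtain a' where a: "a = \<phi> a'" "a' \<in> A" "a' \<noteq> 0" "N a' > 0" using hom(1) by fastforce
    then obtain p b where "p \<in> A" "b \<in> A" "a' = p * b" "N p > 0" "prime_in A p"
      using prime_factor by blast
    then show "\<exists>p\<in>\<phi> ` A. \<exists>b\<in>\<phi> ` A. a = p * b \<and> (N \<circ> inv_into A \<phi>) p > 0 \<and> prime_in (\<phi> ` A) p"
      using a prime by (intro bexI[of _ "\<phi> p"] bexI[of _ "\<phi> b"]) (auto simp: hom)
  qed
qed

subsection \<open>Multivariate polynomials\<close>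

lemma mpoly_as_sum:
  "(f :: 'a::comm_monoid_add mpoly) = (\<Sum>m\<in>Poly_Mapping.keys f. Poly_Mapping.single m (Poly_Mapping.lookup f m))"
proof (rule poly_mapping_eqI)
  fix k
  show "Poly_Mapping.lookup f k = Poly_Mapping.lookup
      (\<Sum>m\<in>Poly_Mapping.keys f. Poly_Mapping.single m (Poly_Mapping.lookup f m)) k"
    by (cases "k \<in> Poly_Mapping.keys f")
      (auto simp: lookup_sum lookup_single when_def sum.delta not_in_keys_iff_lookup_eq_zero)
qed

text \<open>Reduces multiplicativity to monomials, so that the convolution defining the product need
  not be unfolded for evaluation or for the change to rational coefficients.\<close>

lemma hom_mult_of_singles:
  fixes \<phi> :: "'a::comm_ring_1 mpoly \<Rightarrow> 'b::comm_ring_1"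
  assumes add: "\<And>f g. \<phi> (f + g) = \<phi> f + \<phi> g"
    and mult: "\<And>m a n b. \<phi> (Poly_Mapping.single m a * Poly_Mapping.single n b) =
      \<phi> (Poly_Mapping.single m a) * \<phi> (Poly_Mapping.single n b)"
  shows "\<phi> (f * g) = \<phi> f * \<phi> g"
proof -
  have 0: "\<phi> 0 = 0" using add[of 0 0] by simp
  have sum: "\<phi> (sum h I) = (\<Sum>i\<in>I. \<phi> (h i))" for h :: "(nat \<Rightarrow>\<^sub>0 nat) \<Rightarrow> 'a mpoly" and I
    by (induction I rule: infinite_finite_induct) (simp_all add: 0 add)
  define F G where "F = (\<Sum>m\<in>Poly_Mapping.keys f. Poly_Mapping.single m (Poly_Mapping.lookup f m))"
    and "G = (\<Sum>m\<in>Poly_Mapping.keys g. Poly_Mapping.single m (Poly_Mapping.lookup g m))"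
  have "f = F" "g = G" unfolding F_def G_def by (rule mpoly_as_sum)+
  moreover have "\<phi> (F * G) = \<phi> F * \<phi> G" unfolding F_def G_def by (simp only: sum mult sum_product)
  ultimately show ?thesis by simp
qed

section \<open>Evaluation at a point\<close>

definition monom_value :: "(nat \<Rightarrow>\<^sub>0 nat) \<Rightarrow> (nat \<Rightarrow> 'a::comm_semiring_1) \<Rightarrow> 'a" where
  "monom_value m x = (\<Prod>i\<in>Poly_Mapping.keys m. x i ^ Poly_Mapping.lookup m i)"

lemma monom_value_superset:
  "finite S \<Longrightarrow> Poly_Mapping.keys m \<subseteq> S \<Longrightarrow> monom_value m x = (\<Prod>i\<in>S. x i ^ Poly_Mapping.lookup m i)"
  unfolding monom_value_def
  by (rule prod.mono_neutral_left) (auto simp: not_in_keys_iff_lookup_eq_zero)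

lemma monom_value_add: "monom_value (m + n) x = monom_value m x * monom_value n x"
proof -
  let ?S = "Poly_Mapping.keys m \<union> Poly_Mapping.keys n"
  have "monom_value k x = (\<Prod>i\<in>?S. x i ^ Poly_Mapping.lookup k i)" if "k \<in> {m, n, m + n}" for k
    using that Poly_Mapping.keys_add[of m n] by (intro monom_value_superset) auto
  then show ?thesis by (simp add: lookup_add power_add prod.distrib)
qed

lemma eval_mpoly_superset:
  "finite S \<Longrightarrow> Poly_Mapping.keys f \<subseteq> S \<Longrightarrow>
    eval_mpoly f x = (\<Sum>m\<in>S. Poly_Mapping.lookup f m * monom_value m x)"
  unfolding eval_mpoly_def monom_value_def[symmetric]
  by (rule sum.mono_neutral_left) (auto simp: not_in_keys_iff_lookup_eq_zero)

lemma eval_mpoly_single: "eval_mpoly (Poly_Mapping.single m c) x = c * monom_value m x"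
  by (subst eval_mpoly_superset[of "{m}"]) auto

lemma eval_mpoly_0 [simp]: "eval_mpoly 0 x = 0"
  by (simp add: eval_mpoly_def)

lemma eval_mpoly_add: "eval_mpoly (f + g) x = eval_mpoly f x + eval_mpoly g x"
proof -
  let ?S = "Poly_Mapping.keys f \<union> Poly_Mapping.keys g"
  have "eval_mpoly h x = (\<Sum>m\<in>?S. Poly_Mapping.lookup h m * monom_value m x)"
    if "h \<in> {f, g, f + g}" for h
    using that Poly_Mapping.keys_add[of f g] by (intro eval_mpoly_superset) auto
  then show ?thesis by (simp add: lookup_add algebra_simps sum.distrib)
qed

lemma eval_mpoly_mult:
  "eval_mpoly (f * g) x = eval_mpoly f x * eval_mpoly g (x :: nat \<Rightarrow> 'a::comm_ring_1)"
  by (rule hom_mult_of_singles)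
    (simp_all add: eval_mpoly_add mult_single eval_mpoly_single monom_value_add mult_ac)

lemma eval_mpoly_sum: "eval_mpoly (sum h I) x = (\<Sum>i\<in>I. eval_mpoly (h i) x)"
  by (induction I rule: infinite_finite_induct) (simp_all add: eval_mpoly_add)

lemma eval_mpoly_cong:
  assumes "f \<in> mpolys r" "\<And>i. i < r \<Longrightarrow> x i = y i"
  shows "eval_mpoly f x = eval_mpoly f y"
  unfolding eval_mpoly_def
proof (intro sum.cong arg_cong2[of _ _ _ _ "(*)"] prod.cong refl)
  fix m i assume "m \<in> Poly_Mapping.keys f" "i \<in> Poly_Mapping.keys m"
  then have "i < r" using assms(1) by (auto simp: mpolys_def)
  then show "x i ^ Poly_Mapping.lookup m i = y i ^ Poly_Mapping.lookup m i" using assms(2) by simp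
qed

section \<open>Adjoining one more variable\<close>

definition var :: "nat \<Rightarrow> 'a::comm_ring_1 mpoly" where
  "var r = Poly_Mapping.single (Poly_Mapping.single r 1) 1"

lemma var_power: "var r ^ k = Poly_Mapping.single (Poly_Mapping.single r k) 1"
  by (induction k) (simp_all add: var_def mult_single flip: single_add)

lemma eval_mpoly_var [simp]: "eval_mpoly (var r) x = x r"
  by (simp add: var_def eval_mpoly_single monom_value_def)

lemma eval_mpoly_poly:
  "eval_mpoly (poly q (var r)) x = poly (map_poly (\<lambda>c. eval_mpoly c x) q) (x r :: 'a::comm_ring_1)"
  by (induction q) (auto simp: eval_mpoly_add eval_mpoly_mult map_poly_pCons)

lemma single_in_mpolys:
  "Poly_Mapping.keys m \<subseteq> {..<r} \<Longrightarrow> Poly_Mapping.single m c \<in> mpolys r"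
  by (auto simp: mpolys_def)

lemma mpolys_mono: "r \<le> r' \<Longrightarrow> mpolys r \<subseteq> mpolys r'"
  by (fastforce simp: mpolys_def)

lemma subring_mpolys: "subring (mpolys r :: 'a::idom mpoly set)"
proof
  fix f g :: "'a mpoly" assume fg: "f \<in> mpolys r" "g \<in> mpolys r"
  show "f + g \<in> mpolys r"
    using fg Poly_Mapping.keys_add[of f g] unfolding mpolys_def by blast
  show "f * g \<in> mpolys r" unfolding mpolys_def
  proof safe
    fix m i assume "m \<in> Poly_Mapping.keys (f * g)" and i: "i \<in> Poly_Mapping.keys m"
    then obtain a b where "m = a + b" "a \<in> Poly_Mapping.keys f" "b \<in> Poly_Mapping.keys g"
      using keys_mult[of f g] by blast
    then show "i < r" using fg i Poly_Mapping.keys_add[of a b] unfolding mpolys_def by blast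
  qed
next
  fix f :: "'a mpoly" assume "f \<in> mpolys r"
  then show "- f \<in> mpolys r" by (simp add: mpolys_def in_keys_iff)
qed (auto simp: mpolys_def)

lemma mpolys_induct [consumes 1, case_names zero add single]:
  fixes f :: "'a::idom mpoly"
  assumes "f \<in> mpolys r" and "Q 0"
    and add: "\<And>f g. f \<in> mpolys r \<Longrightarrow> g \<in> mpolys r \<Longrightarrow> Q f \<Longrightarrow> Q g \<Longrightarrow> Q (f + g)"
    and single: "\<And>m c. Poly_Mapping.keys m \<subseteq> {..<r} \<Longrightarrow> Q (Poly_Mapping.single m c)"
  shows "Q f"
proof -
  interpret A: subring "mpolys r :: 'a mpoly set" by (rule subring_mpolys)
  have "(\<Sum>m\<in>S. Poly_Mapping.single m (Poly_Mapping.lookup f m)) \<in> mpolys r \<and>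
    Q (\<Sum>m\<in>S. Poly_Mapping.single m (Poly_Mapping.lookup f m))"
    if "S \<subseteq> Poly_Mapping.keys f" for S
    using finite_subset[OF that finite_keys] that
  proof (induction S rule: finite_induct)
    case (insert m S)
    then have "Poly_Mapping.keys m \<subseteq> {..<r}" using assms(1) by (auto simp: mpolys_def)
    then show ?case using insert single_in_mpolys
      by (auto intro!: add single A.add)
  qed (use \<open>Q 0\<close> A.zero in auto)
  then show ?thesis by (subst mpoly_as_sum) simp
qed

lemma poly_in_subring:
  assumes "subring A" "q \<in> polys_over A" "x \<in> A"
  shows "poly q x \<in> A"
proof -
  interpret subring A by fact
  show ?thesis unfolding poly_altdef
    using assms by (intro sum mult power) (auto simp: polys_over_def)
qed

lemma var_in_mpolys: "var r \<in> mpolys (Suc r)"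
  by (auto simp: var_def intro!: single_in_mpolys)

text \<open>The step of the induction on the number of variables. Both rings of multivariate
  polynomials lie in the same type, so the isomorphism with univariate polynomials is evaluation at
  \<open>var r\<close>; \<open>poly_var_eq_0\<close> is its injectivity.\<close>

lemma mpolys_Suc:
  "(\<lambda>q. poly q (var r)) ` polys_over (mpolys r) = (mpolys (Suc r) :: 'a::idom mpoly set)"
proof
  show "(\<lambda>q. poly q (var r)) ` polys_over (mpolys r) \<subseteq> (mpolys (Suc r) :: 'a mpoly set)"
  proof (intro image_subsetI poly_in_subring[OF subring_mpolys] var_in_mpolys)
    fix q :: "'a mpoly poly" assume "q \<in> polys_over (mpolys r)"
    then show "q \<in> polys_over (mpolys (Suc r))"
      using mpolys_mono[of r "Suc r"] unfolding polys_over_def by auto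
  qed
next
  interpret A: subring "mpolys r :: 'a mpoly set" by (rule subring_mpolys)
  interpret P: subring "polys_over (mpolys r) :: 'a mpoly poly set" by (rule A.subring_polys_over)
  show "(mpolys (Suc r) :: 'a mpoly set) \<subseteq> (\<lambda>q. poly q (var r)) ` polys_over (mpolys r)"
  proof
    fix f :: "'a mpoly" assume "f \<in> mpolys (Suc r)"
    then show "f \<in> (\<lambda>q. poly q (var r)) ` polys_over (mpolys r)"
    proof (induction f rule: mpolys_induct)
      case zero
      show ?case using P.zero by (auto intro!: image_eqI[of _ _ 0])
    next
      case (add f g)
      then show ?case using P.add by (auto simp flip: poly_add)
    next
      case (single m c)
      let ?k = "Poly_Mapping.lookup m r"
      let ?m = "m - Poly_Mapping.single r ?k"
      \<comment> \<open>Subtraction of exponents is truncated, but exact here, since precisely the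
        exponent of variable \<open>r\<close> is taken away.\<close>
      have m: "m = ?m + Poly_Mapping.single r ?k"
        by (rule poly_mapping_eqI) (simp add: lookup_add lookup_minus lookup_single when_def)
      have "Poly_Mapping.keys ?m \<subseteq> {..<r}"
      proof
        fix i assume "i \<in> Poly_Mapping.keys ?m"
        then have "i \<in> Poly_Mapping.keys m \<and> i \<noteq> r"
          by (auto simp: in_keys_iff lookup_minus lookup_single when_def split: if_splits)
        then show "i \<in> {..<r}" using single by force
      qed
      then have "monom (Poly_Mapping.single ?m c) ?k \<in> polys_over (mpolys r)"
        by (intro A.monom_in_polys single_in_mpolys)
      moreover have "Poly_Mapping.single m c = poly (monom (Poly_Mapping.single ?m c) ?k) (var r)"
        by (subst m) (simp add: poly_monom var_power mult_single)
      ultimately show ?case by blast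
    qed
  qed
qed

text \<open>The coefficients do not involve variable \<open>r\<close>, so in the monomials of the
  \<open>i\<close>-th term it has exponent exactly \<open>i\<close>. Different terms share no
  monomial, and nothing can cancel.\<close>

lemma poly_var_eq_0:
  assumes q: "q \<in> polys_over (mpolys r :: 'a::idom mpoly set)" and 0: "poly q (var r) = 0"
  shows "q = 0"
proof (rule poly_eqI, rule poly_mapping_eqI)
  fix k m
  show "Poly_Mapping.lookup (coeff q k) m = Poly_Mapping.lookup (coeff 0 k) m"
  proof (cases "m \<in> Poly_Mapping.keys (coeff q k)")
    case False
    then show ?thesis by (simp add: not_in_keys_iff_lookup_eq_zero)
  next
    case True
    let ?u = "m + Poly_Mapping.single r k"
    have no_r: "Poly_Mapping.lookup a r = 0" if "a \<in> Poly_Mapping.keys (coeff q i)" for a i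
      using that q by (force simp: polys_over_def mpolys_def simp flip: not_in_keys_iff_lookup_eq_zero)
    have eq_iff: "a + Poly_Mapping.single r i = ?u \<longleftrightarrow> i = k \<and> a = m"
      if "a \<in> Poly_Mapping.keys (coeff q i)" for a i
    proof
      assume eq: "a + Poly_Mapping.single r i = ?u"
      then have "Poly_Mapping.lookup (a + Poly_Mapping.single r i) r = Poly_Mapping.lookup ?u r"
        by simp
      then have "i = k" using no_r[OF that] no_r[OF True] by (simp add: lookup_add)
      then show "i = k \<and> a = m" using eq by simp
    qed auto
    have coeff_term: "Poly_Mapping.lookup (coeff q i * var r ^ i) ?u =
        (if i = k then Poly_Mapping.lookup (coeff q k) m else 0)" for i
    proof -
      have "coeff q i * var r ^ i = (\<Sum>a\<in>Poly_Mapping.keys (coeff q i).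
          Poly_Mapping.single (a + Poly_Mapping.single r i) (Poly_Mapping.lookup (coeff q i) a))"
        by (subst mpoly_as_sum[of "coeff q i"]) (simp add: sum_distrib_right var_power mult_single)
      then have "Poly_Mapping.lookup (coeff q i * var r ^ i) ?u =
          (\<Sum>a\<in>Poly_Mapping.keys (coeff q i).
            if a + Poly_Mapping.single r i = ?u then Poly_Mapping.lookup (coeff q i) a else 0)"
        by (simp only: lookup_sum lookup_single when_def)
      also have "\<dots> = (\<Sum>a\<in>Poly_Mapping.keys (coeff q i).
            if i = k \<and> a = m then Poly_Mapping.lookup (coeff q i) a else 0)"
        by (intro sum.cong refl) (simp only: eq_iff)
      also have "\<dots> = (if i = k then Poly_Mapping.lookup (coeff q k) m else 0)"
        using True by (auto simp: sum.delta)
      finally show ?thesis .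
    qed
    have "k \<le> degree q" using True by (intro le_degree) auto
    then have "Poly_Mapping.lookup (poly q (var r)) ?u = Poly_Mapping.lookup (coeff q k) m"
      unfolding poly_altdef lookup_sum coeff_term by (simp add: sum.delta)
    then show ?thesis using 0 by simp
  qed
qed

lemma mpolys_0_const: "f \<in> mpolys 0 \<Longrightarrow> f = Poly_Mapping.single 0 (Poly_Mapping.lookup f 0)"
proof (rule poly_mapping_eqI)
  fix m assume "f \<in> mpolys 0"
  then show "Poly_Mapping.lookup f m =
      Poly_Mapping.lookup (Poly_Mapping.single 0 (Poly_Mapping.lookup f 0)) m"
    by (cases "m \<in> Poly_Mapping.keys f")
      (auto simp: mpolys_def lookup_single when_def not_in_keys_iff_lookup_eq_zero)
qed

lemma const_unit:
  fixes c :: rat assumes "c \<noteq> 0"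
  shows "\<exists>e\<in>mpolys r. Poly_Mapping.single 0 c * e = 1"
  using assms by (intro bexI[of _ "Poly_Mapping.single 0 (1 / c)"])
    (auto simp: mult_single intro!: single_in_mpolys)

text \<open>In zero variables the ring is the field of constants, where size 0 throughout is correct
  because every nonzero element is a unit. This is what rational coefficients are for.\<close>

lemma factorial_subring_mpolys: "\<exists>N. factorial_subring (mpolys r :: rat mpoly set) N"
proof (induction r)
  case 0
  interpret subring "mpolys 0 :: rat mpoly set" by (rule subring_mpolys)
  have "factorial_subring (mpolys 0 :: rat mpoly set) (\<lambda>_. 0)"
  proof
    fix a :: "rat mpoly" assume "a \<in> mpolys 0" "a \<noteq> 0"
    then show "\<exists>b\<in>mpolys 0. a * b = 1"
      using mpolys_0_const[of a] const_unit[of "Poly_Mapping.lookup a 0" 0] by (metis single_zero)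
  qed auto
  then show ?case by blast
next
  case (Suc r)
  then obtain N where "factorial_subring (mpolys r :: rat mpoly set) N" by blast
  then have "factorial_subring (polys_over (mpolys r :: rat mpoly set)) (poly_size N)"
    by (rule factorial_subring.factorial_subring_polys_over)
  then show ?case unfolding mpolys_Suc[symmetric]
    by (intro exI) (rule factorial_subring.factorial_subring_image, auto intro: poly_var_eq_0)
qed

section \<open>Integer and rational coefficients\<close>

lemma lookup_rat_mpoly [simp]:
  "Poly_Mapping.lookup (rat_mpoly p) m = of_int (Poly_Mapping.lookup p m)"
  unfolding rat_mpoly_def by transfer (simp add: when_def)

lemma rat_mpoly_eq_iff [simp]: "rat_mpoly p = rat_mpoly q \<longleftrightarrow> p = q"
  by (auto simp: poly_mapping_eq_iff fun_eq_iff)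

lemma rat_mpoly_0 [simp]: "rat_mpoly 0 = 0"
  by (rule poly_mapping_eqI) simp

lemma rat_mpoly_add: "rat_mpoly (p + q) = rat_mpoly p + rat_mpoly q"
  by (rule poly_mapping_eqI) (simp add: lookup_add)

lemma rat_mpoly_diff: "rat_mpoly (p - q) = rat_mpoly p - rat_mpoly q"
  by (rule poly_mapping_eqI) (simp add: lookup_minus)

lemma rat_mpoly_single [simp]:
  "rat_mpoly (Poly_Mapping.single m c) = Poly_Mapping.single m (of_int c)"
  by (rule poly_mapping_eqI) (simp add: lookup_single when_def)

lemma rat_mpoly_mult: "rat_mpoly (p * q) = rat_mpoly p * rat_mpoly q"
  by (rule hom_mult_of_singles) (simp_all add: rat_mpoly_add mult_single)

lemma rat_mpoly_of_int [simp]: "rat_mpoly (of_int c) = of_int c"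
  by (rule poly_mapping_eqI) (simp add: lookup_of_int when_def)

lemma rat_mpoly_var [simp]: "rat_mpoly (var r) = var r"
  by (simp add: var_def)

lemma keys_rat_mpoly [simp]: "Poly_Mapping.keys (rat_mpoly p) = Poly_Mapping.keys p"
  by (auto simp: in_keys_iff)

lemma rat_mpoly_in_mpolys [simp]: "rat_mpoly p \<in> mpolys r \<longleftrightarrow> p \<in> mpolys r"
  by (simp add: mpolys_def)

lemma rat_mpoly_poly: "rat_mpoly (poly q (var r)) = poly (map_poly rat_mpoly q) (var r)"
  by (induction q) (auto simp: rat_mpoly_add rat_mpoly_mult map_poly_pCons)

lemma of_int_in_mpolys: "of_int c \<in> mpolys r"
  by (metis single_of_int single_in_mpolys keys_zero empty_subsetI)

lemma clear_denominators:
  fixes f :: "rat mpoly"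
  assumes "f \<in> mpolys r"
  shows "\<exists>c::int. c \<noteq> 0 \<and> (\<exists>g\<in>mpolys r. of_int c * f = rat_mpoly g)"
  using assms
proof (induction f rule: mpolys_induct)
  case zero
  show ?case by (intro exI[of _ 1] conjI bexI[of _ 0]) (auto simp: mpolys_def)
next
  case (add f g)
  interpret A: subring "mpolys r :: int mpoly set" by (rule subring_mpolys)
  from add obtain c d f' g' where *: "c \<noteq> 0" "d \<noteq> 0" "f' \<in> mpolys r" "g' \<in> mpolys r"
    "of_int c * f = rat_mpoly f'" "of_int d * g = rat_mpoly g'" by blast
  have "of_int (c * d) * (f + g) = of_int d * (of_int c * f) + of_int c * (of_int d * g)"
    by (simp add: algebra_simps)
  also have "\<dots> = rat_mpoly (of_int d * f' + of_int c * g')"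
    using * by (simp add: rat_mpoly_add rat_mpoly_mult)
  finally show ?case using *
    by (intro exI[of _ "c * d"] conjI bexI[of _ "of_int d * f' + of_int c * g'"])
      (auto intro!: A.add A.mult of_int_in_mpolys)
next
  case (single m c)
  obtain a b where ab: "c = of_int a / of_int b" "b > 0"
    using quotient_of_unique[of c] by (metis prod.exhaust quotient_of_div quotient_of_denom_pos)
  have "of_int b * Poly_Mapping.single m c = Poly_Mapping.single 0 (of_int b) * Poly_Mapping.single m c"
    by simp
  also have "\<dots> = rat_mpoly (Poly_Mapping.single m a)"
    using ab by (simp add: mult_single del: single_of_int)
  finally show ?case using ab single_in_mpolys[OF single, of a]
    by (intro exI[of _ b] conjI bexI[of _ "Poly_Mapping.single m a"]) auto
qed

subsection \<open>Elimination of the last variable\<close>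

text \<open>Common divisors are asked to be units rather than of degree 0, a condition that passes
  to the coefficients without comparing degrees. A set is used because the coefficients of all
  members are pooled into one family.\<close>

definition coprime_family :: "nat \<Rightarrow> int mpoly set \<Rightarrow> bool" where
  "coprime_family r F \<longleftrightarrow> (\<exists>f\<in>F. f \<noteq> 0) \<and>
     (\<forall>d\<in>mpolys r. (\<forall>f\<in>F. \<exists>e\<in>mpolys r. rat_mpoly f = d * e) \<longrightarrow> (\<exists>e\<in>mpolys r. d * e = 1))"

lemma coprime_family_of_coprime_mpolys:
  assumes "coprime_mpolys r s P" "i < s" "P i \<noteq> 0"
  shows "coprime_family r (P ` {..<s})"
  unfolding coprime_family_def
proof (intro conjI ballI impI)
  fix d :: "rat mpoly"
  assume d: "d \<in> mpolys r" "\<forall>f\<in>P ` {..<s}. \<exists>e\<in>mpolys r. rat_mpoly f = d * e"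
  then have "\<forall>i<s. mpoly_dvd r d (rat_mpoly (P i))" by (auto simp: mpoly_dvd_def)
  then have "total_degree d = 0"
    using assms(1) d(1) unfolding coprime_mpolys_def by (metis gr0I)
  have key: "m = 0" if "m \<in> Poly_Mapping.keys d" for m
  proof -
    have "(\<Sum>i\<in>Poly_Mapping.keys m. Poly_Mapping.lookup m i) \<le> total_degree d"
      unfolding total_degree_def using that by (intro Max_ge) auto
    then have "\<forall>i\<in>Poly_Mapping.keys m. Poly_Mapping.lookup m i = 0"
      using \<open>total_degree d = 0\<close> by simp
    then show ?thesis by (metis not_in_keys_iff_lookup_eq_zero poly_mapping_eqI lookup_zero)
  qed
  then have "d \<in> mpolys 0" by (auto simp: mpolys_def)
  then have eq: "d = Poly_Mapping.single 0 (Poly_Mapping.lookup d 0)" by (rule mpolys_0_const)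
  \<comment> \<open>Degree 0 makes \<open>d\<close> constant but does not exclude 0, whose
    \<open>total_degree\<close> is 0 by convention; the nonzero \<open>P i\<close> does.\<close>
  obtain e where "rat_mpoly (P i) = d * e" using d assms(2) by blast
  then have "d \<noteq> 0" using assms(3) by (metis mult_zero_left rat_mpoly_0 rat_mpoly_eq_iff)
  then show "\<exists>e\<in>mpolys r. d * e = 1"
    using const_unit[of "Poly_Mapping.lookup d 0" r] eq by (metis single_zero)
qed (use assms in auto)

text \<open>
  The common divisor of the ideal generated by \<open>F\<close> over \<open>\<rat>\<close> is a unit, so the ideal contains a nonzero
  element free of the last variable.
\<close>

lemma elimination:
  assumes F: "finite F" "F \<subseteq> mpolys (Suc r)" and cop: "coprime_family (Suc r) F"
  shows "\<exists>h\<in>mpolys r. h \<noteq> 0 \<and> (\<exists>a. h = (\<Sum>f\<in>F. a f * f))"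
proof -
  define A where "A = (mpolys r :: rat mpoly set)"
  obtain N where "factorial_subring A N" using factorial_subring_mpolys unfolding A_def by blast
  then interpret factorial_subring A N .
  interpret polys: subring "polys_over A" by (rule subring_polys_over)
  define I where "I = {\<Sum>f\<in>F. a f * f | a. True}"
  have I_comb: "u * x - v * y \<in> I" if "x \<in> I" "y \<in> I" for u v x y
  proof -
    from that obtain a b where "x = (\<Sum>f\<in>F. a f * f)" "y = (\<Sum>f\<in>F. b f * f)" by (auto simp: I_def)
    then have "u * x - v * y = (\<Sum>f\<in>F. (u * a f - v * b f) * f)"
      by (simp add: sum_distrib_left algebra_simps sum_subtractf)
    then show ?thesis by (auto simp: I_def)
  qed
  have F_I: "f \<in> I" if "f \<in> F" for f
  proof -
    have eq: "f = (\<Sum>g\<in>F. (if g = f then 1 else 0) * g)"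
      using F that by (simp add: if_distrib[of "\<lambda>x. x * _"] sum.delta cong: if_cong)
    show ?thesis unfolding I_def mem_Collect_eq
      by (rule exI[of _ "\<lambda>g. if g = f then 1 else 0"]) (rule conjI[OF eq TrueI])
  qed
  have I_0: "0 \<in> I" by (auto simp: I_def intro!: exI[of _ "\<lambda>_. 0"])
  \<comment> \<open>The ideal over the rationals, read in the last variable. Carrying an integer
    multiple that lands in \<open>I\<close> keeps a way back to integer coefficients.\<close>
  define J where "J = {q \<in> polys_over A. \<exists>c::int. c \<noteq> 0 \<and>
    (\<exists>x\<in>I. of_int c * poly q (var r) = rat_mpoly x)}"
  have J: "J \<subseteq> polys_over A" by (auto simp: J_def)
  have J_diff: "p - q \<in> J" if "p \<in> J" "q \<in> J" for p q
  proof -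
    from that obtain c d x y where *: "p \<in> polys_over A" "q \<in> polys_over A" "c \<noteq> 0" "d \<noteq> 0"
      "x \<in> I" "y \<in> I" "of_int c * poly p (var r) = rat_mpoly x" "of_int d * poly q (var r) = rat_mpoly y"
      by (auto simp: J_def)
    have "of_int (c * d) * poly (p - q) (var r) =
        of_int d * (of_int c * poly p (var r)) - of_int c * (of_int d * poly q (var r))"
      by (simp add: algebra_simps)
    also have "\<dots> = rat_mpoly (of_int d * x - of_int c * y)"
      using * by (simp add: rat_mpoly_diff rat_mpoly_mult)
    finally have "of_int (c * d) * poly (p - q) (var r) = rat_mpoly (of_int d * x - of_int c * y)" .
    moreover have "c * d \<noteq> 0" "p - q \<in> polys_over A" using * by (auto intro: polys.diff)
    ultimately show ?thesis using I_comb[OF *(5,6)] unfolding J_def by blast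
  qed
  have J_mult: "g * q \<in> J" if "q \<in> J" "g \<in> polys_over A" for q g
  proof -
    from that obtain c x where *: "q \<in> polys_over A" "c \<noteq> 0" "x \<in> I"
      "of_int c * poly q (var r) = rat_mpoly x" by (auto simp: J_def)
    have "poly g (var r) \<in> mpolys (Suc r)" using that mpolys_Suc unfolding A_def by blast
    then obtain d g' where d: "d \<noteq> 0" "of_int d * poly g (var r) = rat_mpoly g'"
      using clear_denominators by blast
    have "of_int (c * d) * poly (g * q) (var r) =
        (of_int d * poly g (var r)) * (of_int c * poly q (var r))"
      by (simp add: algebra_simps)
    also have "\<dots> = rat_mpoly (g' * x)" using * d by (simp add: rat_mpoly_mult)
    finally have "of_int (c * d) * poly (g * q) (var r) = rat_mpoly (g' * x)" .
    moreover have "g' * x \<in> I" using I_comb[OF *(3) I_0, of g' 0] by simp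
    moreover have "c * d \<noteq> 0" "g * q \<in> polys_over A" using * d that by (auto intro: polys.mult)
    ultimately show ?thesis unfolding J_def by blast
  qed
  have F_J: "\<exists>q\<in>J. rat_mpoly f = poly q (var r)" if "f \<in> F" for f
  proof -
    have "rat_mpoly f \<in> mpolys (Suc r)" using F that by auto
    then obtain q where q: "q \<in> polys_over A" "rat_mpoly f = poly q (var r)"
      unfolding A_def mpolys_Suc[symmetric] by blast
    then have "q \<in> J" using F_I[OF that] unfolding J_def by (force intro!: exI[of _ 1])
    then show ?thesis using q by blast
  qed
  obtain f0 where "f0 \<in> F" "f0 \<noteq> 0" using cop by (auto simp: coprime_family_def)
  then obtain q0 where q0: "q0 \<in> J" "rat_mpoly f0 = poly q0 (var r)" using F_J by blast
  have "q0 \<noteq> 0" using q0 \<open>f0 \<noteq> 0\<close> by (metis poly_0 rat_mpoly_0 rat_mpoly_eq_iff)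
  then obtain c d where cd: "c \<in> A" "c \<noteq> 0" "d \<in> polys_over A" "d \<noteq> 0" "[:c:] * d \<in> J"
    and div: "\<And>f. f \<in> J \<Longrightarrow> \<exists>q\<in>polys_over A. f = d * q"
    using ideal_common_divisor[OF J J_diff J_mult q0(1)] by blast
  have in_Suc: "poly q (var r) \<in> mpolys (Suc r)" if "q \<in> polys_over A" for q
    using that mpolys_Suc unfolding A_def by blast
  have "\<exists>e\<in>mpolys (Suc r). rat_mpoly f = poly d (var r) * e" if f: "f \<in> F" for f
  proof -
    obtain q where q: "q \<in> J" "rat_mpoly f = poly q (var r)" using F_J f by blast
    then obtain g where "g \<in> polys_over A" "q = d * g" using div by blast
    then show ?thesis using q in_Suc by (intro bexI[of _ "poly g (var r)"]) auto
  qed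
  then obtain e where "e \<in> mpolys (Suc r)" "poly d (var r) * e = 1"
    using cop in_Suc cd unfolding coprime_family_def by blast
  then obtain g where g: "g \<in> polys_over A" "poly d (var r) * poly g (var r) = 1"
    unfolding A_def mpolys_Suc[symmetric] by blast
  \<comment> \<open>Injectivity of evaluation turns the unit equation into one between univariate
    polynomials, where degrees show that \<open>d\<close> is constant; then \<open>[:c:] * d\<close>
    is free of the last variable.\<close>
  have "poly (d * g - 1) (var r) = 0" using g by simp
  then have "d * g - 1 = 0"
    using poly_var_eq_0[of "d * g - 1" r] cd g polys.diff polys.mult polys.one unfolding A_def by blast
  then have "d * g = 1" by simp
  then have "degree (d * g) = 0" "g \<noteq> 0" by auto
  then have "degree d = 0" using cd by (simp add: degree_mult_eq)
  then obtain b where b: "d = [:b:]" by (auto elim: degree_eq_zeroE)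
  have h: "c * b \<in> A" "c * b \<noteq> 0" using b cd mult by auto
  obtain k x where k: "k \<noteq> 0" "x \<in> I" "of_int k * (c * b) = rat_mpoly x"
    using cd(5) b by (auto simp: J_def mult.commute)
  obtain l y where l: "l \<noteq> 0" "y \<in> mpolys r" "of_int l * (c * b) = rat_mpoly y"
    using clear_denominators[of "c * b" r] h unfolding A_def by blast
  \<comment> \<open>Here \<open>x\<close> lies in the ideal and \<open>y\<close> in
    \<open>mpolys r\<close>, and each represents an integer multiple of \<open>c * b\<close>. Their
    common multiple has both properties.\<close>
  have "rat_mpoly (of_int k * y) = rat_mpoly (of_int l * x)"
    unfolding rat_mpoly_mult rat_mpoly_of_int k(3)[symmetric] l(3)[symmetric]
    by (rule mult.left_commute)
  then have "of_int k * y = of_int l * x" by simp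
  moreover have "of_int l * x \<in> I" using I_comb[OF k(2) I_0, of "of_int l" 0] by simp
  moreover have "y \<noteq> 0" using l h by auto
  then have "of_int k * y \<noteq> 0" using k by simp
  moreover have "of_int k * y \<in> mpolys r"
    using l subring.mult[OF subring_mpolys] of_int_in_mpolys by blast
  ultimately show ?thesis unfolding I_def by force
qed

text \<open>On \<open>mpolys (Suc r)\<close> there is exactly one candidate, by
  \<open>mpolys_Suc\<close> and \<open>poly_var_eq_0\<close>; elsewhere nothing is known about the
  value.\<close>

definition as_univariate :: "nat \<Rightarrow> 'a::idom mpoly \<Rightarrow> 'a mpoly poly" where
  "as_univariate r f = (SOME q. q \<in> polys_over (mpolys r) \<and> poly q (var r) = f)"

lemma as_univariate:
  assumes "f \<in> mpolys (Suc r)"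
  shows "as_univariate r f \<in> polys_over (mpolys r)" "poly (as_univariate r f) (var r) = f"
proof -
  have "\<exists>q. q \<in> polys_over (mpolys r) \<and> poly q (var r) = f"
    using assms unfolding mpolys_Suc[symmetric] by blast
  from someI_ex[OF this, folded as_univariate_def]
  show "as_univariate r f \<in> polys_over (mpolys r)" "poly (as_univariate r f) (var r) = f"
    by (blast, blast)
qed

definition coeff_family :: "nat \<Rightarrow> int mpoly set \<Rightarrow> int mpoly set" where
  "coeff_family r F = (\<Union>f\<in>F. set (coeffs (as_univariate r f)))"

lemma finite_coeff_family: "finite F \<Longrightarrow> finite (coeff_family r F)"
  by (simp add: coeff_family_def)

lemma coeff_family_subset: "F \<subseteq> mpolys (Suc r) \<Longrightarrow> coeff_family r F \<subseteq> mpolys r"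
proof (unfold coeff_family_def, intro UN_least)
  fix f assume "F \<subseteq> mpolys (Suc r)" "f \<in> F"
  then have "as_univariate r f \<in> polys_over (mpolys r)" using as_univariate(1) by blast
  then show "set (coeffs (as_univariate r f)) \<subseteq> mpolys r"
    by (auto simp: polys_over_def coeffs_def)
qed

text \<open>A divisor of all coefficients of all members divides the members themselves, hence is a
  unit in \<open>Suc r\<close> variables. Its inverse might involve the last variable; the constant
  coefficient of that inverse is an inverse in \<open>r\<close> variables.\<close>

lemma coprime_coeff_family:
  assumes F: "F \<subseteq> mpolys (Suc r)" and cop: "coprime_family (Suc r) F"
  shows "coprime_family r (coeff_family r F)"
  unfolding coprime_family_def
proof (intro conjI ballI impI)
  obtain f where f: "f \<in> F" "f \<noteq> 0" using cop by (auto simp: coprime_family_def)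
  then have "as_univariate r f \<noteq> 0" using as_univariate(2)[of f r] F by auto
  then have "lead_coeff (as_univariate r f) \<in> coeff_family r F" "lead_coeff (as_univariate r f) \<noteq> 0"
    using f by (auto simp: coeff_family_def intro!: bexI[of _ f] coeff_in_coeffs)
  then show "\<exists>f\<in>coeff_family r F. f \<noteq> 0" by blast
next
  interpret A: subring "mpolys r :: rat mpoly set" by (rule subring_mpolys)
  interpret P: subring "polys_over (mpolys r) :: rat mpoly poly set" by (rule A.subring_polys_over)
  fix d :: "rat mpoly"
  assume d: "d \<in> mpolys r" and div: "\<forall>f\<in>coeff_family r F. \<exists>e\<in>mpolys r. rat_mpoly f = d * e"
  have "\<exists>e\<in>mpolys (Suc r). rat_mpoly f = d * e" if f: "f \<in> F" for f
  proof -
    have "\<exists>e\<in>mpolys r. coeff (map_poly rat_mpoly (as_univariate r f)) k = d * e" for k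
    proof (cases "coeff (as_univariate r f) k \<in> coeff_family r F")
      case True
      then show ?thesis using div by (simp add: coeff_map_poly)
    next
      case False
      \<comment> \<open>\<open>coeffs\<close> stops at the degree, so a coefficient missing from it
        is 0.\<close>
      then have "coeff (as_univariate r f) k = 0"
        using f coeff_in_coeffs[of "as_univariate r f" k] le_degree[of "as_univariate r f" k]
        unfolding coeff_family_def by (metis UN_I coeff_0)
      then show ?thesis using A.zero by (auto simp: coeff_map_poly intro!: bexI[of _ 0])
    qed
    then obtain h where h: "h \<in> polys_over (mpolys r)" "map_poly rat_mpoly (as_univariate r f) = [:d:] * h"
      using A.divisible_coeffs by blast
    have "rat_mpoly f = rat_mpoly (poly (as_univariate r f) (var r))" using as_univariate(2)[of f r] f F by auto
    also have "\<dots> = d * poly h (var r)" unfolding rat_mpoly_poly h by simp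
    finally show ?thesis using h mpolys_Suc by blast
  qed
  moreover have "d \<in> mpolys (Suc r)" using d mpolys_mono[of r "Suc r"] by auto
  ultimately obtain e where "e \<in> mpolys (Suc r)" "d * e = 1"
    using cop unfolding coprime_family_def by blast
  then obtain q where q: "q \<in> polys_over (mpolys r)" "d * poly q (var r) = 1"
    unfolding mpolys_Suc[symmetric] by blast
  have "[:d:] * q - 1 \<in> polys_over (mpolys r)" using q d
    by (intro P.diff P.mult P.one) simp_all
  moreover have "poly ([:d:] * q - 1) (var r) = 0" using q by simp
  ultimately have "[:d:] * q - 1 = 0" by (rule poly_var_eq_0)
  then have "coeff ([:d:] * q) 0 = 1" by simp
  then show "\<exists>e\<in>mpolys r. d * e = 1" using q by (auto simp: polys_over_def)
qed

subsection \<open>Counting points in boxes\<close>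

lemma finite_box [simp]: "finite (box r B)"
  unfolding box_def by (intro finite_PiE) auto

lemma card_box [simp]: "card (box r B) = B ^ r"
  unfolding box_def by (subst card_PiE) auto

lemma finite_int_interval_filter [simp]: "finite {x::int. a \<le> x \<and> x < b \<and> Q x}"
  by (rule finite_subset[of _ "{a..<b}"]) auto

lemma box_Suc: "bij_betw (\<lambda>(n, x). n(r := x)) (box r B \<times> {0..<int B}) (box (Suc r) B)"
proof (rule bij_betwI[where g = "\<lambda>n. (n(r := undefined), n r)"])
  show "(\<lambda>(n, x). n(r := x)) \<in> box r B \<times> {0..<int B} \<rightarrow> box (Suc r) B"
    by (auto simp: box_def PiE_def Pi_def extensional_def less_Suc_eq)
  show "(\<lambda>n. (n(r := undefined), n r)) \<in> box (Suc r) B \<rightarrow> box r B \<times> {0..<int B}"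
    by (auto simp: box_def PiE_def Pi_def extensional_def less_Suc_eq)
next
  fix y assume "y \<in> box r B \<times> {0..<int B}"
  then show "(\<lambda>n. (n(r := undefined), n r)) ((\<lambda>(n, x). n(r := x)) y) = y"
    by (auto simp: box_def PiE_def extensional_def fun_eq_iff)
qed auto

lemma card_by_fibers:
  assumes "S \<subseteq> box (Suc r) B"
  shows "card S = (\<Sum>n\<in>box r B. card {x\<in>{0..<int B}. n(r := x) \<in> S})"
proof -
  let ?\<phi> = "\<lambda>(n, x). n(r := x)"
  let ?T = "SIGMA n:box r B. {x\<in>{0..<int B}. n(r := x) \<in> S}"
  have bij: "bij_betw ?\<phi> (box r B \<times> {0..<int B}) (box (Suc r) B)" by (rule box_Suc)
  have "?\<phi> ` ?T = S"
  proof
    show "S \<subseteq> ?\<phi> ` ?T"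
    proof
      fix m assume "m \<in> S"
      then have "m \<in> ?\<phi> ` (box r B \<times> {0..<int B})" using assms bij by (auto simp: bij_betw_def)
      then show "m \<in> ?\<phi> ` ?T" using \<open>m \<in> S\<close> by force
    qed
  qed auto
  moreover have "inj_on ?\<phi> ?T"
    using bij by (auto simp: bij_betw_def elim!: inj_on_subset)
  ultimately have "card S = card ?T" using card_image by fastforce
  then show ?thesis by simp
qed

text \<open>Lagrange's bound, stated over the integers with pairwise incongruent roots. Dividing by
  the linear factor of a root \<open>a\<close> leaves the remainder \<open>poly q a\<close>, a
  multiple of \<open>p\<close>, so the quotient is again nonzero modulo \<open>p\<close>; primality
  turns the other roots of \<open>q\<close> into roots of the quotient.\<close>

lemma card_roots_mod_prime:
  fixes q :: "int poly"
  assumes "prime p" "finite S" "inj_on (\<lambda>x. x mod p) S"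
    and "\<And>x. x \<in> S \<Longrightarrow> p dvd poly q x" and "\<not> [:p:] dvd q"
  shows "card S \<le> degree q"
  using assms(2-)
proof (induction "degree q" arbitrary: q S)
  case 0
  then obtain c where c: "q = [:c:]" using degree_eq_zeroE by metis
  have "S = {}"
  proof (rule ccontr)
    assume "S \<noteq> {}"
    then have "p dvd c" using 0 c by auto
    then show False using 0 c by (auto simp: const_poly_dvd_const_poly_iff)
  qed
  then show ?case by simp
next
  case (Suc n)
  show ?case
  proof (cases "S = {}")
    case False
    then obtain a where a: "a \<in> S" by blast
    define g where "g = synthetic_div q a"
    have q: "q = [:- a, 1:] * g + [:poly q a:]"
      unfolding g_def by (rule synthetic_div_correct'[symmetric])
    have g_dvd: "\<not> [:p:] dvd g"
    proof
      assume "[:p:] dvd g"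
      moreover have "[:p:] dvd [:poly q a:]" using Suc.prems a by (auto simp: const_poly_dvd_const_poly_iff)
      ultimately have "[:p:] dvd [:- a, 1:] * g + [:poly q a:]" by (intro dvd_add dvd_mult)
      then show False using Suc.prems q by simp
    qed
    have "card (S - {a}) \<le> degree g"
    proof (rule Suc.hyps(1))
      show "n = degree g" unfolding g_def degree_synthetic_div using Suc.hyps(2) by simp
      show "inj_on (\<lambda>x. x mod p) (S - {a})" using Suc.prems by (auto intro: inj_on_diff)
      fix x assume x: "x \<in> S - {a}"
      have "poly q x = (x - a) * poly g x + poly q a"
        using arg_cong[OF q, of "\<lambda>f. poly f x"] by (simp add: algebra_simps)
      moreover have "p dvd poly q x" "p dvd poly q a" using x a Suc.prems by auto
      ultimately have "p dvd (x - a) * poly g x" by (simp add: dvd_add_left_iff)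
      moreover have "\<not> p dvd x - a"
        using x a Suc.prems(2) by (auto simp: inj_on_def mod_eq_dvd_iff)
      ultimately show "p dvd poly g x" using assms(1) prime_dvd_multD by blast
    qed (use Suc.prems g_dvd in auto)
    moreover have "degree g = n" unfolding g_def degree_synthetic_div using Suc.hyps(2) by simp
    ultimately show ?thesis using a Suc by (simp add: card_Diff_singleton)
  qed simp
qed

text \<open>Each block of \<open>p\<close> consecutive integers holds at most
  \<open>degree q\<close> roots, and \<open>B div p + 1\<close> blocks cover the interval, the last
  one reaching past \<open>B\<close>.\<close>

lemma card_roots_mod_prime_interval:
  fixes q :: "int poly"
  assumes p: "prime (p :: nat)" and q: "\<not> [:int p:] dvd q"
  shows "card {x\<in>{0..<int B}. int p dvd poly q x} \<le> (B div p + 1) * degree q"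
proof -
  have "p > 0" using p prime_gt_0_nat by blast
  let ?I = "\<lambda>j. {x\<in>{int j * int p..<int j * int p + int p}. int p dvd poly q x}"
  have "x \<in> (\<Union>j\<le>B div p. ?I j)" if "x \<in> {x\<in>{0..<int B}. int p dvd poly q x}" for x
  proof -
    have x: "0 \<le> x" "x < int B" "int p dvd poly q x" using that by auto
    let ?j = "nat x div p"
    have "x = int (nat x)" using x by simp
    also have "\<dots> = int ?j * int p + int (nat x mod p)"
      by (metis div_mult_mod_eq of_nat_add of_nat_mult)
    finally have "x = int ?j * int p + int (nat x mod p)" .
    moreover have "nat x mod p < p" using \<open>p > 0\<close> by simp
    ultimately have "x \<in> ?I ?j" using x by auto
    moreover have "?j \<le> B div p" using x by (intro div_le_mono) simp
    ultimately show ?thesis by blast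
  qed
  then have "card {x\<in>{0..<int B}. int p dvd poly q x} \<le> card (\<Union>j\<le>B div p. ?I j)"
    by (intro card_mono) auto
  also have "\<dots> \<le> (\<Sum>j\<le>B div p. card (?I j))" by (rule card_UN_le) simp
  also have "\<dots> \<le> (\<Sum>j\<le>B div p. degree q)"
  proof (intro sum_mono card_roots_mod_prime[where p = "int p"])
    fix j
    show "inj_on (\<lambda>x. x mod int p) (?I j)"
    proof (rule inj_onI)
      fix x y assume "x \<in> ?I j" "y \<in> ?I j" "x mod int p = y mod int p"
      then have "int p dvd x - y" "\<bar>x - y\<bar> < int p" by (auto simp: mod_eq_dvd_iff)
      then show "x = y" using zdvd_not_zless[of "\<bar>x - y\<bar>" "int p"] by auto
    qed
  qed (use p q in auto)
  finally show ?thesis by simp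
qed

section \<open>Fibers in the direction of the last coordinate\<close>

definition slice :: "nat \<Rightarrow> int mpoly \<Rightarrow> (nat \<Rightarrow> int) \<Rightarrow> int poly" where
  "slice r f n = map_poly (\<lambda>c. eval_mpoly c n) (as_univariate r f)"

lemma coeff_slice: "coeff (slice r f n) k = eval_mpoly (coeff (as_univariate r f) k) n"
  by (simp add: slice_def coeff_map_poly)

lemma degree_slice: "degree (slice r f n) \<le> degree (as_univariate r f)"
  unfolding slice_def by (rule map_poly_degree_leq)

lemma eval_mpoly_upd:
  assumes "f \<in> mpolys r"
  shows "eval_mpoly f (n(r := x)) = eval_mpoly f n"
  by (rule eval_mpoly_cong[OF assms]) auto

lemma eval_mpoly_slice:
  assumes "f \<in> mpolys (Suc r)"
  shows "eval_mpoly f (n(r := x)) = poly (slice r f n) x"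
proof -
  have "eval_mpoly f (n(r := x)) = eval_mpoly (poly (as_univariate r f) (var r)) (n(r := x))"
    using as_univariate(2)[OF assms] by simp
  also have "\<dots> = poly (map_poly (\<lambda>c. eval_mpoly c (n(r := x))) (as_univariate r f)) x"
    by (simp add: eval_mpoly_poly)
  also have "map_poly (\<lambda>c. eval_mpoly c (n(r := x))) (as_univariate r f) = slice r f n"
    using as_univariate(1)[OF assms]
    by (intro poly_eqI) (simp add: coeff_map_poly coeff_slice polys_over_def eval_mpoly_upd)
  finally show ?thesis .
qed

text \<open>A single coefficient not divisible by \<open>p\<close> at \<open>n\<close> keeps the
  slice nonzero modulo \<open>p\<close>. The degree is taken before specialization, so that the
  constant factor does not depend on \<open>n\<close>.\<close>

lemma card_fiber_roots:
  assumes f: "f \<in> mpolys (Suc r)" and p: "prime (p :: nat)"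
    and c: "\<not> int p dvd eval_mpoly (coeff (as_univariate r f) k) n"
  shows "real (card {x\<in>{0..<int B}. int p dvd eval_mpoly f (n(r := x))})
    \<le> real (degree (as_univariate r f)) * (real B / real p + 1)"
proof -
  have "\<not> [:int p:] dvd slice r f n" using c by (auto simp: const_poly_dvd_iff coeff_slice)
  then have "card {x\<in>{0..<int B}. int p dvd eval_mpoly f (n(r := x))} \<le>
      (B div p + 1) * degree (slice r f n)"
    unfolding eval_mpoly_slice[OF f] using card_roots_mod_prime_interval p by blast
  also have "\<dots> \<le> (B div p + 1) * degree (as_univariate r f)"
    by (intro mult_left_mono degree_slice) simp
  finally have "real (card {x\<in>{0..<int B}. int p dvd eval_mpoly f (n(r := x))}) \<le>
      real ((B div p + 1) * degree (as_univariate r f))" by (rule of_nat_mono)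
  also have "\<dots> = real (degree (as_univariate r f)) * (real (B div p) + 1)"
    by (simp add: algebra_simps)
  also have "real (B div p) \<le> real B / real p"
    by (metis floor_divide_of_nat_eq of_int_floor_le of_int_of_nat_eq)
  then have "real (degree (as_univariate r f)) * (real (B div p) + 1) \<le>
      real (degree (as_univariate r f)) * (real B / real p + 1)"
    by (intro mult_left_mono add_right_mono) auto
  finally show ?thesis .
qed

text \<open>Induction through the leading coefficient in the last variable: where it vanishes modulo
  \<open>p\<close>, the whole line of \<open>B\<close> points is conceded; elsewhere at most
  \<open>degree q\<close> residues remain. The term \<open>1 / real B\<close> accounts for primes
  exceeding \<open>B\<close>. Primes up to \<open>p0\<close> are left out because they may divide
  all coefficients of \<open>h\<close>.\<close>

lemma card_zeros_mod_prime:
  fixes h :: "int mpoly"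
  assumes "h \<in> mpolys r" "h \<noteq> 0"
  shows "\<exists>C\<ge>0. \<exists>p0. \<forall>p>p0. prime p \<longrightarrow> (\<forall>B\<ge>1.
    real (card {n\<in>box r B. int p dvd eval_mpoly h n}) \<le> C * real B ^ r * (1 / real p + 1 / real B))"
  using assms
proof (induction r arbitrary: h)
  case 0
  define c where "c = Poly_Mapping.lookup h 0"
  have h: "h = Poly_Mapping.single 0 c" unfolding c_def using 0 mpolys_0_const by blast
  then have "c \<noteq> 0" using 0 by auto
  have "{n\<in>box 0 B. int p dvd eval_mpoly h n} = {}" if "p > nat \<bar>c\<bar>" for p B :: nat
  proof -
    have "\<not> int p dvd c" using zdvd_not_zless[of "\<bar>c\<bar>" "int p"] \<open>c \<noteq> 0\<close> that by auto
    then show ?thesis by (simp add: h eval_mpoly_single monom_value_def)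
  qed
  then show ?case by (intro exI[of _ "0::real"] conjI exI[of _ "nat \<bar>c\<bar>"]) simp_all
next
  case (Suc r)
  define q where "q = as_univariate r h"
  have q: "q \<in> polys_over (mpolys r)" "poly q (var r) = h"
    using as_univariate[of h r] Suc.prems by (auto simp: q_def)
  have "lead_coeff q \<in> mpolys r" "lead_coeff q \<noteq> 0" using q Suc.prems by (auto simp: polys_over_def)
  then obtain C p0 where C: "C \<ge> 0" and IH: "\<And>p B. p > p0 \<Longrightarrow> prime p \<Longrightarrow> B \<ge> 1 \<Longrightarrow>
      real (card {n\<in>box r B. int p dvd eval_mpoly (lead_coeff q) n})
        \<le> C * real B ^ r * (1 / real p + 1 / real B)"
    using Suc.IH by blast
  define d where "d = real (degree q)"
  have "real (card {n\<in>box (Suc r) B. int p dvd eval_mpoly h n})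
      \<le> (C + d) * real B ^ Suc r * (1 / real p + 1 / real B)"
    if p: "p > p0" "prime p" and B: "B \<ge> 1" for p B :: nat
  proof -
    let ?S = "{n\<in>box (Suc r) B. int p dvd eval_mpoly h n}"
    let ?Z = "{n\<in>box r B. int p dvd eval_mpoly (lead_coeff q) n}"
    have fiber: "real (card {x\<in>{0..<int B}. n(r := x) \<in> ?S}) \<le>
        (if n \<in> ?Z then real B else 0) + d * (real B / real p + 1)" if n: "n \<in> box r B" for n
    proof (cases "n \<in> ?Z")
      case True
      have "card {x\<in>{0..<int B}. n(r := x) \<in> ?S} \<le> card {0..<int B}"
        by (intro card_mono) auto
      moreover have "0 \<le> d * (real B / real p + 1)" by (simp add: d_def)
      ultimately show ?thesis using True by simp
    next
      case False
      have "card {x\<in>{0..<int B}. n(r := x) \<in> ?S} \<le>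
          card {x\<in>{0..<int B}. int p dvd eval_mpoly h (n(r := x))}"
        by (intro card_mono) auto
      moreover have "real (card {x\<in>{0..<int B}. int p dvd eval_mpoly h (n(r := x))}) \<le>
          d * (real B / real p + 1)"
        unfolding d_def q_def
        by (rule card_fiber_roots[where k = "degree q"]) (use Suc.prems p False n in \<open>auto simp: q_def\<close>)
      ultimately show ?thesis using False by simp
    qed
    have "real (card ?S) = (\<Sum>n\<in>box r B. real (card {x\<in>{0..<int B}. n(r := x) \<in> ?S}))"
      by (subst card_by_fibers[of ?S]) auto
    also have "\<dots> \<le> (\<Sum>n\<in>box r B. (if n \<in> ?Z then real B else 0) + d * (real B / real p + 1))"
      by (intro sum_mono fiber)
    also have "\<dots> = real (card ?Z) * real B + real B ^ r * (d * (real B / real p + 1))"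
      by (simp add: sum.distrib sum.If_cases Int_def)
    also have "\<dots> \<le> (C * real B ^ r * (1 / real p + 1 / real B)) * real B
        + real B ^ r * (d * (real B / real p + 1))"
      using IH[OF p B] by (intro add_right_mono mult_right_mono) auto
    also have "\<dots> = (C + d) * real B ^ Suc r * (1 / real p + 1 / real B)"
      using B by (simp add: field_simps)
    finally show ?thesis .
  qed
  moreover have "C + d \<ge> 0" using C by (simp add: d_def)
  ultimately show ?case by blast
qed

text \<open>An integer zero is a zero modulo every prime. A prime beyond \<open>B\<close> makes
  \<open>1 / real p\<close> at most \<open>1 / real B\<close>, whence the factor 2.\<close>

lemma card_zeros:
  fixes h :: "int mpoly"
  assumes C: "\<And>p B. p > p0 \<Longrightarrow> prime p \<Longrightarrow> B \<ge> 1 \<Longrightarrow>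
    real (card {n\<in>box r B. int p dvd eval_mpoly h n}) \<le> C * real B ^ r * (1 / real p + 1 / real B)"
    and "C \<ge> 0" "B \<ge> 1"
  shows "real (card {n\<in>box r B. eval_mpoly h n = 0}) \<le> 2 * C * real B ^ r / real B"
proof -
  obtain p where p: "prime p" "p > max p0 B" using bigger_prime by blast
  have "card {n\<in>box r B. eval_mpoly h n = 0} \<le> card {n\<in>box r B. int p dvd eval_mpoly h n}"
    by (intro card_mono) auto
  then have "real (card {n\<in>box r B. eval_mpoly h n = 0}) \<le>
      C * real B ^ r * (1 / real p + 1 / real B)"
    using C[of p B] p \<open>B \<ge> 1\<close> by simp
  also have "\<dots> \<le> C * real B ^ r * (1 / real B + 1 / real B)"
    using p \<open>B \<ge> 1\<close> \<open>C \<ge> 0\<close> by (intro mult_left_mono add_right_mono divide_left_mono) auto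
  finally show ?thesis by (simp add: mult_ac)
qed

section \<open>Size of values and their large prime divisors\<close>

lemma eval_mpoly_bound:
  fixes h :: "int mpoly"
  assumes "h \<in> mpolys r"
  obtains D k :: nat where
    "\<And>B n. B \<ge> 1 \<Longrightarrow> n \<in> box r B \<Longrightarrow> \<bar>eval_mpoly h n\<bar> \<le> int D * int B ^ k"
proof
  \<comment> \<open>A crude exponent: the sum of the degrees of all monomials dominates each of
    them, and only polynomial growth in \<open>B\<close> matters.\<close>
  define k where "k = (\<Sum>m\<in>Poly_Mapping.keys h. \<Sum>i\<in>Poly_Mapping.keys m. Poly_Mapping.lookup m i)"
  define D where "D = nat (\<Sum>m\<in>Poly_Mapping.keys h. \<bar>Poly_Mapping.lookup h m\<bar>)"
  fix B n assume B: "B \<ge> 1" and n: "n \<in> box r B"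
  have k: "(\<Sum>i\<in>Poly_Mapping.keys m. Poly_Mapping.lookup m i) \<le> k" if "m \<in> Poly_Mapping.keys h" for m
    unfolding k_def by (rule member_le_sum[OF that]) auto
  have mon: "\<bar>monom_value m n\<bar> \<le> int B ^ k" if m: "m \<in> Poly_Mapping.keys h" for m
  proof -
    have "\<bar>monom_value m n\<bar> = (\<Prod>i\<in>Poly_Mapping.keys m. \<bar>n i\<bar> ^ Poly_Mapping.lookup m i)"
      by (simp add: monom_value_def abs_prod power_abs)
    also have "\<dots> \<le> (\<Prod>i\<in>Poly_Mapping.keys m. int B ^ Poly_Mapping.lookup m i)"
    proof (intro prod_mono conjI power_mono)
      fix i assume "i \<in> Poly_Mapping.keys m"
      then have "i < r" using assms m unfolding mpolys_def by blast
      then have "n i \<in> {0..<int B}" using PiE_mem[OF n[unfolded box_def], of i] by simp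
      then show "\<bar>n i\<bar> \<le> int B" by simp
    qed auto
    also have "\<dots> = int B ^ (\<Sum>i\<in>Poly_Mapping.keys m. Poly_Mapping.lookup m i)"
      by (simp add: power_sum)
    also have "\<dots> \<le> int B ^ k" using B k[OF m] by (intro power_increasing) auto
    finally show ?thesis .
  qed
  have "\<bar>eval_mpoly h n\<bar> \<le> (\<Sum>m\<in>Poly_Mapping.keys h. \<bar>Poly_Mapping.lookup h m * monom_value m n\<bar>)"
    unfolding eval_mpoly_def monom_value_def[symmetric] by (rule sum_abs)
  also have "\<dots> \<le> (\<Sum>m\<in>Poly_Mapping.keys h. \<bar>Poly_Mapping.lookup h m\<bar> * int B ^ k)"
    unfolding abs_mult by (intro sum_mono mult_left_mono mon) auto
  also have "\<dots> = int D * int B ^ k" by (simp add: D_def sum_distrib_right sum_nonneg)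
  finally show "\<bar>eval_mpoly h n\<bar> \<le> int D * int B ^ k" .
qed

text \<open>The product of distinct primes dividing \<open>z\<close> divides \<open>z\<close>, so
  \<open>B ^ card P\<close> is at most \<open>B ^ k\<close>; exponents can be compared because
  \<open>B\<close> is at least 2.\<close>

lemma card_large_prime_divisors:
  fixes z :: int
  assumes P: "finite P" "\<And>p. p \<in> P \<Longrightarrow> prime p \<and> p > B \<and> int p dvd z"
    and z: "z \<noteq> 0" "\<bar>z\<bar> \<le> int B ^ k" and B: "B \<ge> 2"
  shows "card P \<le> k"
proof -
  have "(\<Prod>p\<in>P. int p) dvd z" using P
  proof (induction P rule: finite_induct)
    case (insert p P)
    have "coprime (int p) (\<Prod>q\<in>P. int q)"
    proof (intro prod_coprime_right)
      fix q assume "q \<in> P"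
      then have "prime q" "prime p" "p \<noteq> q" using insert by auto
      then show "coprime (int p) (int q)" by (simp add: primes_coprime)
    qed
    then show ?case using insert by (auto intro: divides_mult)
  qed simp
  then have "(\<Prod>p\<in>P. int p) \<le> \<bar>z\<bar>" using z by (intro zdvd_imp_le) auto
  moreover have "int B ^ card P \<le> (\<Prod>p\<in>P. int p)"
    using prod_mono[of P "\<lambda>_. int B" int] P by force
  ultimately have "int B ^ card P \<le> int B ^ k" using z by simp
  then show ?thesis using B by (simp add: power_le_imp_le_exp)
qed

text \<open>Telescoping: \<open>1 / n^2\<close> is at most
  \<open>1 / (n - 1) - 1 / n\<close>.\<close>

lemma sum_inverse_squares_tail:
  assumes "M \<ge> 1"
  shows "(\<Sum>p\<in>{M<..B}. 1 / real p ^ 2) \<le> 1 / real M"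
proof (cases "M \<le> B")
  case True
  then have "(\<Sum>p\<in>{M<..B}. 1 / real p ^ 2) \<le> 1 / real M - 1 / real B"
  proof (induction B rule: dec_induct)
    case (step B)
    have "{M<..Suc B} = insert (Suc B) {M<..B}" using step by auto
    then have "(\<Sum>p\<in>{M<..Suc B}. 1 / real p ^ 2) = 1 / real (Suc B) ^ 2 + (\<Sum>p\<in>{M<..B}. 1 / real p ^ 2)"
      by simp
    also have "1 / real (Suc B) ^ 2 \<le> 1 / real B - 1 / real (Suc B)"
    proof -
      have "B > 0" using step assms by simp
      have "1 / real (Suc B) ^ 2 \<le> 1 / (real B * real (Suc B))"
        using \<open>B > 0\<close> by (intro divide_left_mono) (auto simp: power2_eq_square)
      also have "\<dots> = 1 / real B - 1 / real (Suc B)" using \<open>B > 0\<close> by (simp add: field_simps)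
      finally show ?thesis .
    qed
    finally show ?case using step by simp
  qed simp
  also have "\<dots> \<le> 1 / real M" by simp
  finally show ?thesis .
qed simp

section \<open>Points with a common prime divisor beyond \<open>M\<close>\<close>

definition bad_points :: "nat \<Rightarrow> int mpoly set \<Rightarrow> nat \<Rightarrow> nat \<Rightarrow> (nat \<Rightarrow> int) set" where
  "bad_points r F M B = {n\<in>box r B. \<exists>p>M. prime p \<and> (\<forall>f\<in>F. int p dvd eval_mpoly f n)}"

lemma finite_bad_points [simp]: "finite (bad_points r F M B)"
  by (simp add: bad_points_def)

text \<open>
  Above a point \<open>n\<close> that is not bad for the coefficients, a prime dividing all values divides \<open>h\<close> at \<open>n\<close>.
  Primes up to \<open>B\<close> cost at most \<open>2 d B / p\<close> points each; larger primes cost at most \<open>2 d\<close> each, and at most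
  \<open>k\<close> of them divide a nonzero integer of size at most \<open>B ^ k\<close>.
\<close>

lemma card_fiber_bad_points:
  assumes F: "finite F" "F \<subseteq> mpolys (Suc r)"
    and h: "h \<in> mpolys r" "h = (\<Sum>f\<in>F. a f * f)"
    and d: "\<And>f. f \<in> F \<Longrightarrow> degree (as_univariate r f) \<le> d"
    and n: "n \<in> box r B" "n \<notin> bad_points r (coeff_family r F) M B" "eval_mpoly h n \<noteq> 0"
    and k: "\<bar>eval_mpoly h n\<bar> \<le> int B ^ k" and B: "B \<ge> 2"
  shows "real (card {x\<in>{0..<int B}. n(r := x) \<in> bad_points (Suc r) F M B}) \<le>
    (\<Sum>p | p \<in> {M<..B} \<and> prime p \<and> int p dvd eval_mpoly h n. 2 * real d * real B / real p)
      + 2 * real d * real k"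
proof -
  define P where "P = {p. p > M \<and> prime p \<and> int p dvd eval_mpoly h n}"
  define R where "R p = {x\<in>{0..<int B}. \<forall>f\<in>F. int p dvd eval_mpoly f (n(r := x))}" for p
  have "P \<subseteq> {..nat \<bar>eval_mpoly h n\<bar>}"
    using n(3) by (auto simp: P_def dest!: dvd_imp_le_int)
  then have "finite P" using finite_subset by blast
  have R: "real (card (R p)) \<le> real d * (real B / real p + 1)" if p: "p \<in> P" for p
  proof -
    \<comment> \<open>As \<open>n\<close> is not bad for the coefficients and \<open>p\<close>
      exceeds \<open>M\<close>, some coefficient survives modulo \<open>p\<close>.\<close>
    obtain g where g: "g \<in> coeff_family r F" "\<not> int p dvd eval_mpoly g n"
      using n p by (auto simp: bad_points_def P_def)
    then obtain f k where f: "f \<in> F" "g = coeff (as_univariate r f) k"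
      by (auto simp: coeff_family_def coeffs_def split: if_splits)
    have "card (R p) \<le> card {x\<in>{0..<int B}. int p dvd eval_mpoly f (n(r := x))}"
      using f by (intro card_mono) (auto simp: R_def)
    then have "real (card (R p)) \<le> real (card {x\<in>{0..<int B}. int p dvd eval_mpoly f (n(r := x))})"
      by simp
    also have "\<dots> \<le> real (degree (as_univariate r f)) * (real B / real p + 1)"
      using f g F p by (intro card_fiber_roots[where k = k]) (auto simp: P_def)
    also have "\<dots> \<le> real d * (real B / real p + 1)" using d f by (intro mult_right_mono) auto
    finally show ?thesis .
  qed
  have "{x\<in>{0..<int B}. n(r := x) \<in> bad_points (Suc r) F M B} \<subseteq> (\<Union>p\<in>P. R p)"
  proof
    fix x assume x: "x \<in> {x\<in>{0..<int B}. n(r := x) \<in> bad_points (Suc r) F M B}"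
    then obtain p where p: "p > M" "prime p" "\<forall>f\<in>F. int p dvd eval_mpoly f (n(r := x))"
      by (auto simp: bad_points_def)
    \<comment> \<open>Since \<open>h\<close> ignores coordinate \<open>r\<close>, its value at
      \<open>n\<close> is a combination of the values of \<open>F\<close> at every point of the
      fiber.\<close>
    have "eval_mpoly h n = eval_mpoly h (n(r := x))" using eval_mpoly_upd h(1) by metis
    also have "\<dots> = (\<Sum>f\<in>F. eval_mpoly (a f) (n(r := x)) * eval_mpoly f (n(r := x)))"
      by (subst h(2)) (simp add: eval_mpoly_sum eval_mpoly_mult)
    finally have "int p dvd eval_mpoly h n" using p by (simp add: dvd_sum)
    then show "x \<in> (\<Union>p\<in>P. R p)" using p x by (auto simp: P_def R_def)
  qed
  then have "card {x\<in>{0..<int B}. n(r := x) \<in> bad_points (Suc r) F M B} \<le> card (\<Union>p\<in>P. R p)"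
    using \<open>finite P\<close> by (intro card_mono) (auto simp: R_def)
  also have "\<dots> \<le> (\<Sum>p\<in>P. card (R p))" by (rule card_UN_le[OF \<open>finite P\<close>])
  finally have "real (card {x\<in>{0..<int B}. n(r := x) \<in> bad_points (Suc r) F M B}) \<le>
      (\<Sum>p\<in>P. real (card (R p)))" unfolding of_nat_sum[symmetric] by (rule of_nat_mono)
  also have "\<dots> \<le> (\<Sum>p\<in>P. real d * (real B / real p + 1))" by (intro sum_mono R)
  also have "\<dots> = (\<Sum>p\<in>P \<inter> {..B}. real d * (real B / real p + 1)) +
      (\<Sum>p\<in>P - {..B}. real d * (real B / real p + 1))"
    using sum.Int_Diff[OF \<open>finite P\<close>] by blast
  \<comment> \<open>For \<open>p\<close> at most \<open>B\<close> the summand 1 is absorbed by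
    \<open>B / p\<close>; for larger \<open>p\<close> the quotient \<open>B / p\<close> is absorbed
    by 1.\<close>
  also have "\<dots> \<le> (\<Sum>p\<in>P \<inter> {..B}. 2 * real d * real B / real p) + (\<Sum>p\<in>P - {..B}. 2 * real d)"
  proof (intro add_mono sum_mono)
    fix p assume "p \<in> P \<inter> {..B}"
    then have "p > 0" "p \<le> B" by (auto simp: P_def prime_gt_0_nat)
    then have "real d * (real B / real p + 1) \<le> real d * (real B / real p + real B / real p)"
      by (intro mult_left_mono add_left_mono) (auto simp: field_simps)
    then show "real d * (real B / real p + 1) \<le> 2 * real d * real B / real p" by simp
  next
    fix p assume "p \<in> P - {..B}"
    then have "real d * (real B / real p + 1) \<le> real d * (1 + 1)"
      by (intro mult_left_mono add_right_mono) auto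
    then show "real d * (real B / real p + 1) \<le> 2 * real d" by simp
  qed
  also have "P \<inter> {..B} = {p. p \<in> {M<..B} \<and> prime p \<and> int p dvd eval_mpoly h n}"
    by (auto simp: P_def)
  also have "(\<Sum>p\<in>P - {..B}. 2 * real d) \<le> 2 * real d * real k"
  proof -
    have "card (P - {..B}) \<le> k"
    proof (rule card_large_prime_divisors[OF _ _ n(3) k B])
      show "finite (P - {..B})" using \<open>finite P\<close> by blast
      show "prime p \<and> B < p \<and> int p dvd eval_mpoly h n" if "p \<in> P - {..B}" for p
        using that unfolding P_def by simp
    qed
    then have "real (card (P - {..B})) * (2 * real d) \<le> real k * (2 * real d)"
      by (intro mult_right_mono) auto
    then show ?thesis by (simp add: mult_ac)
  qed
  finally show ?thesis by (simp del: fun_upd_apply)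
qed

text \<open>Four sources contribute: full fibers over bad points of the coefficient family, treated
  by induction; full fibers over zeros of \<open>h\<close>; primes between \<open>M\<close> and
  \<open>B\<close>; primes beyond \<open>B\<close>. A threshold \<open>K\<close> appears already in
  zero variables, since small primes may divide all the constants.\<close>

lemma card_bad_points:
  assumes "finite F" "F \<subseteq> mpolys r" "coprime_family r F"
  shows "\<exists>C\<ge>0. \<exists>K. \<forall>M\<ge>K. \<forall>B\<ge>K.
    real (card (bad_points r F M B)) \<le> C * real B ^ r * (1 / real M + 1 / real B)"
  using assms
proof (induction r arbitrary: F)
  case 0
  obtain f where f: "f \<in> F" "f \<noteq> 0" using 0 by (auto simp: coprime_family_def)
  define c where "c = Poly_Mapping.lookup f 0"
  have fc: "f = Poly_Mapping.single 0 c" unfolding c_def using 0 f mpolys_0_const by blast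
  then have "c \<noteq> 0" using f by auto
  have "bad_points 0 F M B = {}" if "M \<ge> nat \<bar>c\<bar>" for M B :: nat
  proof -
    have "\<not> int p dvd eval_mpoly f n" if "p > M" for p n
      using zdvd_not_zless[of "\<bar>c\<bar>" "int p"] \<open>c \<noteq> 0\<close> that \<open>M \<ge> nat \<bar>c\<bar>\<close>
      by (auto simp: fc eval_mpoly_single monom_value_def)
    then show ?thesis using f by (auto simp: bad_points_def)
  qed
  then show ?case by (intro exI[of _ "0::real"] conjI exI[of _ "nat \<bar>c\<bar>"]) simp_all
next
  case (Suc r)
  let ?G = "coeff_family r F"
  obtain C1 K1 where C1: "C1 \<ge> 0" and IH: "\<And>M B. M \<ge> K1 \<Longrightarrow> B \<ge> K1 \<Longrightarrow>
      real (card (bad_points r ?G M B)) \<le> C1 * real B ^ r * (1 / real M + 1 / real B)"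
    using Suc.IH[of ?G] Suc.prems finite_coeff_family coeff_family_subset coprime_coeff_family
    by meson
  obtain h a where h: "h \<in> mpolys r" "h \<noteq> 0" "h = (\<Sum>f\<in>F. a f * f)"
    using elimination[OF Suc.prems] by blast
  obtain C2 p2 where C2: "C2 \<ge> 0" and zeros: "\<And>p B. p > p2 \<Longrightarrow> prime p \<Longrightarrow> B \<ge> 1 \<Longrightarrow>
      real (card {n\<in>box r B. int p dvd eval_mpoly h n}) \<le> C2 * real B ^ r * (1 / real p + 1 / real B)"
    using card_zeros_mod_prime[OF h(1,2)] by blast
  obtain D k0 where Dk: "\<And>B n. B \<ge> 1 \<Longrightarrow> n \<in> box r B \<Longrightarrow> \<bar>eval_mpoly h n\<bar> \<le> int D * int B ^ k0"
    using eval_mpoly_bound[OF h(1)] by blast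
  define d where "d = (\<Sum>f\<in>F. degree (as_univariate r f))"
  have d: "degree (as_univariate r f) \<le> d" if "f \<in> F" for f
    unfolding d_def using that Suc.prems by (intro member_le_sum) auto
  \<comment> \<open>One more factor \<open>B\<close> absorbs \<open>D\<close>, since
    \<open>B\<close> will be at least \<open>K\<close> and hence at least \<open>D\<close>.\<close>
  define k where "k = Suc k0"
  define K where "K = Max {K1, p2, D, 2}"
  \<comment> \<open>In order: bad points of the coefficients, zeros of \<open>h\<close>, primes
    between \<open>M\<close> and \<open>B\<close>, primes beyond \<open>B\<close>.\<close>
  define C where "C = C1 + 2 * C2 + 4 * real d * C2 + 2 * real d * real k"
  have C0: "C \<ge> 0" using C1 C2 by (simp add: C_def)
  have "real (card (bad_points (Suc r) F M B)) \<le> C * real B ^ Suc r * (1 / real M + 1 / real B)"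
    if "M \<ge> K" "B \<ge> K" for M B
  proof -
    have M: "M \<ge> K1" "M \<ge> p2" "M \<ge> 2" and B: "B \<ge> K1" "B \<ge> D" "B \<ge> 2"
      using that by (auto simp: K_def)
    let ?S = "bad_points (Suc r) F M B"
    let ?bad = "bad_points r ?G M B"
    let ?Z = "{n\<in>box r B. eval_mpoly h n = 0}"
    let ?Q = "{p\<in>{M<..B}. prime p}"
    let ?w = "\<lambda>p. 2 * real d * real B / real p"
    let ?Zp = "\<lambda>p. {n\<in>box r B. int p dvd eval_mpoly h n}"
    have fiber: "real (card {x\<in>{0..<int B}. n(r := x) \<in> ?S}) \<le>
        (if n \<in> ?bad then real B else 0) + (if n \<in> ?Z then real B else 0) +
        (\<Sum>p\<in>?Q. if n \<in> ?Zp p then ?w p else 0) + 2 * real d * real k" if n: "n \<in> box r B" for n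
    proof (cases "n \<in> ?bad \<or> n \<in> ?Z")
      case True
      have "card {x\<in>{0..<int B}. n(r := x) \<in> ?S} \<le> card {0..<int B}"
        by (intro card_mono) auto
      then have "real (card {x\<in>{0..<int B}. n(r := x) \<in> ?S}) \<le> real B" by simp
      also have "real B \<le> (if n \<in> ?bad then real B else 0) + (if n \<in> ?Z then real B else 0)"
        using True by auto
      finally have "real (card {x\<in>{0..<int B}. n(r := x) \<in> ?S}) \<le>
        (if n \<in> ?bad then real B else 0) + (if n \<in> ?Z then real B else 0)" .
      moreover have "0 \<le> (\<Sum>p\<in>?Q. if n \<in> ?Zp p then ?w p else 0)" by (intro sum_nonneg) auto
      moreover have "0 \<le> 2 * real d * real k" by simp
      ultimately show ?thesis by linarith
    next
      case False
      have "\<bar>eval_mpoly h n\<bar> \<le> int D * int B ^ k0" using Dk n B by simp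
      also have "\<dots> \<le> int B ^ k" unfolding k_def power_Suc using B by (intro mult_right_mono) auto
      finally have "real (card {x\<in>{0..<int B}. n(r := x) \<in> ?S}) \<le>
          (\<Sum>p | p \<in> {M<..B} \<and> prime p \<and> int p dvd eval_mpoly h n. ?w p) + 2 * real d * real k"
        using False n B by (intro card_fiber_bad_points[OF Suc.prems(1,2) h(1,3) d]) auto
      also have "(\<Sum>p | p \<in> {M<..B} \<and> prime p \<and> int p dvd eval_mpoly h n. ?w p) =
          (\<Sum>p\<in>?Q. if n \<in> ?Zp p then ?w p else 0)"
        using n by (simp add: sum.inter_filter[symmetric] conj_ac cong: conj_cong)
      finally have *: "real (card {x\<in>{0..<int B}. n(r := x) \<in> ?S}) \<le>
          (\<Sum>p\<in>?Q. if n \<in> ?Zp p then ?w p else 0) + 2 * real d * real k" .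
      have "(if n \<in> ?bad then real B else 0) = 0" "(if n \<in> ?Z then real B else 0) = 0"
        using False by auto
      then show ?thesis using * by (simp only: add_0_left)
    qed
    \<comment> \<open>Two savings of \<open>1 / p\<close> meet here: zeros of \<open>h\<close>
      modulo \<open>p\<close>, and roots in the fiber. In the factor 4, one 2 comes from replacing
      \<open>1 / real B\<close> by \<open>1 / real p\<close>, the other from
      \<open>?w\<close>.\<close>
    have zp: "real (card (?Zp p)) * ?w p \<le> 4 * real d * C2 * real B ^ Suc r * (1 / real p ^ 2)"
      if p: "p \<in> ?Q" for p
    proof -
      have "p > 0" "p \<le> B" "p > p2" "prime p" using p M by auto
      have "real (card (?Zp p)) \<le> C2 * real B ^ r * (1 / real p + 1 / real B)"
        using zeros p M B by simp
      also have "\<dots> \<le> C2 * real B ^ r * (1 / real p + 1 / real p)"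
        using \<open>p > 0\<close> \<open>p \<le> B\<close> C2 by (intro mult_left_mono add_left_mono divide_left_mono) auto
      finally have "real (card (?Zp p)) * ?w p \<le> C2 * real B ^ r * (1 / real p + 1 / real p) * ?w p"
        by (intro mult_right_mono) auto
      also have "\<dots> = 4 * real d * C2 * real B ^ Suc r * (1 / real p ^ 2)"
        by (simp add: field_simps power2_eq_square)
      finally show ?thesis .
    qed
    have "real (card ?S) = (\<Sum>n\<in>box r B. real (card {x\<in>{0..<int B}. n(r := x) \<in> ?S}))"
      by (subst card_by_fibers[of ?S]) (auto simp: bad_points_def)
    also have "\<dots> \<le> (\<Sum>n\<in>box r B.
        (if n \<in> ?bad then real B else 0) + (if n \<in> ?Z then real B else 0) +
        (\<Sum>p\<in>?Q. if n \<in> ?Zp p then ?w p else 0) + 2 * real d * real k)"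
      by (intro sum_mono fiber)
    \<comment> \<open>The sums over points and primes are exchanged, so that for each
      \<open>p\<close> one counts the points at which \<open>p\<close> divides the value of
      \<open>h\<close>.\<close>
    also have "\<dots> = (\<Sum>n\<in>box r B. if n \<in> ?bad then real B else 0) +
        (\<Sum>n\<in>box r B. if n \<in> ?Z then real B else 0) +
        (\<Sum>p\<in>?Q. \<Sum>n\<in>box r B. if n \<in> ?Zp p then ?w p else 0) + real B ^ r * (2 * real d * real k)"
      by (simp only: sum.distrib sum.swap[of _ ?Q "box r B"] sum_constant card_box of_nat_power)
    also have "(\<Sum>n\<in>box r B. if n \<in> ?bad then real B else 0) = real (card ?bad) * real B"
    proof -
      have "box r B \<inter> ?bad = ?bad" by (auto simp: bad_points_def)
      then show ?thesis by (simp add: sum.If_cases)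
    qed
    also have "(\<Sum>n\<in>box r B. if n \<in> ?Z then real B else 0) = real (card ?Z) * real B"
      by (simp add: sum.If_cases Int_def)
    also have "(\<Sum>p\<in>?Q. \<Sum>n\<in>box r B. if n \<in> ?Zp p then ?w p else 0) =
        (\<Sum>p\<in>?Q. real (card (?Zp p)) * ?w p)"
      by (intro sum.cong refl) (simp add: sum.If_cases Int_def)
    also have "real (card ?bad) * real B \<le> (C1 * real B ^ r * (1 / real M + 1 / real B)) * real B"
      using IH M B by (intro mult_right_mono) auto
    also have "real (card ?Z) * real B \<le> (2 * C2 * real B ^ r / real B) * real B"
      using card_zeros[OF zeros C2] B by (intro mult_right_mono) auto
    also have "(\<Sum>p\<in>?Q. real (card (?Zp p)) * ?w p) \<le>
        (\<Sum>p\<in>?Q. 4 * real d * C2 * real B ^ Suc r * (1 / real p ^ 2))"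
      by (intro sum_mono zp)
    also have "\<dots> \<le> (\<Sum>p\<in>{M<..B}. 4 * real d * C2 * real B ^ Suc r * (1 / real p ^ 2))"
      using C2 by (intro sum_mono2) auto
    also have "\<dots> = 4 * real d * C2 * real B ^ Suc r * (\<Sum>p\<in>{M<..B}. 1 / real p ^ 2)"
      by (simp only: sum_distrib_left)
    also have "\<dots> \<le> 4 * real d * C2 * real B ^ Suc r * (1 / real M)"
      using sum_inverse_squares_tail[of M B] M C2 by (intro mult_left_mono) auto
    also have "C1 * real B ^ r * (1 / real M + 1 / real B) * real B + 2 * C2 * real B ^ r / real B * real B
        + 4 * real d * C2 * real B ^ Suc r * (1 / real M) + real B ^ r * (2 * real d * real k) =
        real B ^ Suc r * ((C1 + 4 * real d * C2) * (1 / real M)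
          + (C1 + 2 * C2 + 2 * real d * real k) * (1 / real B))"
      using B M by (simp add: field_simps)
    also have "\<dots> \<le> real B ^ Suc r * (C * (1 / real M) + C * (1 / real B))"
    proof -
      have "C1 + 4 * real d * C2 \<le> C" "C1 + 2 * C2 + 2 * real d * real k \<le> C"
        using C1 C2 by (simp_all add: C_def)
      then show ?thesis by (intro mult_left_mono add_mono mult_right_mono) simp_all
    qed
    also have "\<dots> = C * real B ^ Suc r * (1 / real M + 1 / real B)" by (simp add: algebra_simps)
    finally show ?thesis by simp
  qed
  then show ?case using C0 by blast
qed

subsection \<open>Densities of periodic sets\<close>

text \<open>Nothing is required of the coordinates from \<open>r\<close> on, so the predicate cannot
  depend on them; this lets \<open>S\<close> be applied to restricted functions.\<close>

definition periodic :: "nat \<Rightarrow> nat \<Rightarrow> ((nat \<Rightarrow> int) \<Rightarrow> bool) \<Rightarrow> bool" where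
  "periodic r q S \<longleftrightarrow> (\<forall>m n. (\<forall>i<r. [m i = n i] (mod int q)) \<longrightarrow> S m = S n)"

lemma bij_betw_PiE_pair:
  assumes "bij_betw (\<lambda>x. (u x, v x)) Z (X \<times> Y)"
  shows "bij_betw (\<lambda>n. (\<lambda>i\<in>I. u (n i), \<lambda>i\<in>I. v (n i))) (I \<rightarrow>\<^sub>E Z) ((I \<rightarrow>\<^sub>E X) \<times> (I \<rightarrow>\<^sub>E Y))"
proof -
  define w where "w = inv_into Z (\<lambda>x. (u x, v x))"
  have uv: "u x \<in> X" "v x \<in> Y" "w (u x, v x) = x" if "x \<in> Z" for x
    using that assms bij_betw_inv_into_left[OF assms that] by (auto simp: w_def bij_betw_def)
  have w: "w (x, y) \<in> Z" "u (w (x, y)) = x" "v (w (x, y)) = y" if "x \<in> X" "y \<in> Y" for x y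
  proof -
    have xy: "(x, y) \<in> X \<times> Y" using that by simp
    show "w (x, y) \<in> Z" unfolding w_def using bij_betw_inv_into[OF assms] xy
      by (auto simp: bij_betw_def)
    show "u (w (x, y)) = x" "v (w (x, y)) = y"
      using bij_betw_inv_into_right[OF assms xy] by (auto simp: w_def)
  qed
  show ?thesis
  proof (rule bij_betwI[where g = "\<lambda>(a, b). \<lambda>i\<in>I. w (a i, b i)"])
    show "(\<lambda>n. (\<lambda>i\<in>I. u (n i), \<lambda>i\<in>I. v (n i))) \<in> (I \<rightarrow>\<^sub>E Z) \<rightarrow> (I \<rightarrow>\<^sub>E X) \<times> (I \<rightarrow>\<^sub>E Y)"
      using uv by (auto simp: PiE_iff)
    show "(\<lambda>(a, b). \<lambda>i\<in>I. w (a i, b i)) \<in> (I \<rightarrow>\<^sub>E X) \<times> (I \<rightarrow>\<^sub>E Y) \<rightarrow> (I \<rightarrow>\<^sub>E Z)"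
      using w by (auto simp: PiE_iff)
  next
    fix n assume "n \<in> I \<rightarrow>\<^sub>E Z"
    then show "(\<lambda>(a, b). \<lambda>i\<in>I. w (a i, b i)) ((\<lambda>n. (\<lambda>i\<in>I. u (n i), \<lambda>i\<in>I. v (n i))) n) = n"
      using uv by (auto simp: PiE_iff fun_eq_iff extensional_def)
  next
    fix y assume "y \<in> (I \<rightarrow>\<^sub>E X) \<times> (I \<rightarrow>\<^sub>E Y)"
    then show "(\<lambda>n. (\<lambda>i\<in>I. u (n i), \<lambda>i\<in>I. v (n i))) ((\<lambda>(a, b). \<lambda>i\<in>I. w (a i, b i)) y) = y"
      using w by (auto simp: PiE_iff fun_eq_iff extensional_def)
  qed
qed

text \<open>Each coordinate is split separately into a pair. This serves twice: residue and quotient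
  handle boxes whose side is a multiple of the period, and two residues give the Chinese remainder
  theorem.\<close>

lemma card_box_pair:
  assumes bij: "bij_betw (\<lambda>x. (u x, v x)) {0..<int c} ({0..<int a} \<times> {0..<int b})"
    and S: "\<And>n. n \<in> box r c \<Longrightarrow>
      S n \<longleftrightarrow> T (\<lambda>i\<in>{..<r}. u (n i)) \<and> U (\<lambda>i\<in>{..<r}. v (n i))"
  shows "card {n\<in>box r c. S n} = card {n\<in>box r a. T n} * card {n\<in>box r b. U n}"
proof -
  let ?\<phi> = "\<lambda>n. (\<lambda>i\<in>{..<r}. u (n i), \<lambda>i\<in>{..<r}. v (n i))"
  have \<phi>: "bij_betw ?\<phi> (box r c) (box r a \<times> box r b)"
    unfolding box_def by (rule bij_betw_PiE_pair[OF bij])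
  have "bij_betw ?\<phi> {n\<in>box r c. S n} ({n\<in>box r a. T n} \<times> {n\<in>box r b. U n})"
  proof (rule bij_betw_subset[OF \<phi>])
    have "?\<phi> ` {n\<in>box r c. S n} = {y \<in> ?\<phi> ` box r c. T (fst y) \<and> U (snd y)}"
      using S by auto
    also have "?\<phi> ` box r c = box r a \<times> box r b" using \<phi> by (auto simp: bij_betw_def)
    finally have eq: "?\<phi> ` {n\<in>box r c. S n} = {y \<in> box r a \<times> box r b. T (fst y) \<and> U (snd y)}" .
    show "?\<phi> ` {n\<in>box r c. S n} = {n\<in>box r a. T n} \<times> {n\<in>box r b. U n}"
      unfolding eq by auto
  qed auto
  from bij_betw_same_card[OF this] show ?thesis by (simp only: card_cartesian_product)
qed

lemma periodic_mod:
  assumes "periodic r q S"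
  shows "S (\<lambda>i\<in>{..<r}. n i mod int q) \<longleftrightarrow> S n"
proof -
  have "\<forall>i<r. [(\<lambda>i\<in>{..<r}. n i mod int q) i = n i] (mod int q)" by simp
  then show ?thesis using assms unfolding periodic_def by blast
qed

lemma card_periodic_multiple:
  assumes "periodic r q S" "q > 0"
  shows "card {n\<in>box r (k * q). S n} = k ^ r * card {n\<in>box r q. S n}"
proof -
  have "bij_betw (\<lambda>x. (x mod int q, x div int q)) {0..<int (k * q)} ({0..<int q} \<times> {0..<int k})"
  proof (rule bij_betwI[where g = "\<lambda>(a, b). a + int q * b"])
    show "(\<lambda>x. (x mod int q, x div int q)) \<in> {0..<int (k * q)} \<rightarrow> {0..<int q} \<times> {0..<int k}"
    proof (intro funcsetI)
      fix x assume x: "x \<in> {0..<int (k * q)}"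
      have "x div int q * int q \<le> x" using assms(2) by (simp add: div_times_less_eq_dividend minus_mod_eq_div_mult [symmetric])
      also have "x < int k * int q" using x by simp
      finally have "x div int q < int k" using assms(2) by (simp add: mult_less_cancel_right)
      then show "(x mod int q, x div int q) \<in> {0..<int q} \<times> {0..<int k}"
        using assms(2) x by (simp add: pos_imp_zdiv_nonneg_iff)
    qed
    show "(\<lambda>(a, b). a + int q * b) \<in> {0..<int q} \<times> {0..<int k} \<rightarrow> {0..<int (k * q)}"
    proof safe
      fix a b assume ab: "a \<in> {0..<int q}" "b \<in> {0..<int k}"
      have "a + int q * b < int q * (b + 1)" using ab by (simp add: algebra_simps)
      also have "\<dots> \<le> int q * int k" using ab by (intro mult_left_mono) auto
      finally show "a + int q * b \<in> {0..<int (k * q)}" using ab by (simp add: mult.commute)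
    qed
  qed (use assms(2) in auto)
  \<comment> \<open>The quotients are unconstrained, so the second count is that of the entire box
    of side \<open>k\<close>.\<close>
  then have "card {n\<in>box r (k * q). S n} = card {n\<in>box r q. S n} * card {n\<in>box r k. True}"
    by (rule card_box_pair) (simp add: periodic_mod[OF assms(1)])
  then show ?thesis by simp
qed

text \<open>Coprimality gives injectivity; equal cardinalities do the rest.\<close>

lemma bij_betw_crt:
  assumes "coprime a b" "a > 0" "b > 0"
  shows "bij_betw (\<lambda>x. (x mod int a, x mod int b)) {0..<int (a * b)} ({0..<int a} \<times> {0..<int b})"
proof (rule bij_betw_imageI)
  let ?\<phi> = "\<lambda>x. (x mod int a, x mod int b)"
  show inj: "inj_on ?\<phi> {0..<int (a * b)}"
  proof (rule inj_onI)
    fix x y assume xy: "x \<in> {0..<int (a * b)}" "y \<in> {0..<int (a * b)}" "?\<phi> x = ?\<phi> y"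
    then have "int a dvd x - y" "int b dvd x - y" by (auto simp: mod_eq_dvd_iff)
    then have "int a * int b dvd x - y" using assms(1) by (intro divides_mult) auto
    then have "[x = y] (mod (int a * int b))" by (simp add: cong_iff_dvd_diff)
    then show "x = y" using xy by (auto simp: cong_def)
  qed
  have "?\<phi> ` {0..<int (a * b)} \<subseteq> {0..<int a} \<times> {0..<int b}" using assms by auto
  moreover have "card (?\<phi> ` {0..<int (a * b)}) = card ({0..<int a} \<times> {0..<int b})"
    using card_image[OF inj] by (simp add: card_cartesian_product nat_mult_distrib)
  ultimately show "?\<phi> ` {0..<int (a * b)} = {0..<int a} \<times> {0..<int b}"
    by (intro card_subset_eq) auto
qed

lemma card_periodic_coprime:
  assumes "coprime a b" "a > 0" "b > 0" "periodic r a S" "periodic r b T"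
  shows "card {n\<in>box r (a * b). S n \<and> T n} = card {n\<in>box r a. S n} * card {n\<in>box r b. T n}"
  by (rule card_box_pair[OF bij_betw_crt[OF assms(1-3)]])
    (simp add: periodic_mod[OF assms(4)] periodic_mod[OF assms(5)])

lemma periodic_dvd:
  assumes "periodic r a S" "a dvd b"
  shows "periodic r b S"
  using assms unfolding periodic_def by (meson cong_dvd_modulus of_nat_dvd_iff)

text \<open>Periodicity accompanies the count because the induction step treats all primes handled
  so far as one condition, whose period is coprime to the new prime.\<close>

lemma card_periodic_primes:
  assumes "finite A" "\<And>p. p \<in> A \<Longrightarrow> prime p" "\<And>p. p \<in> A \<Longrightarrow> periodic r p (S p)"
  shows "periodic r (\<Prod>A) (\<lambda>n. \<forall>p\<in>A. S p n) \<and>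
    card {n\<in>box r (\<Prod>A). \<forall>p\<in>A. S p n} = (\<Prod>p\<in>A. card {n\<in>box r p. S p n})"
  using assms
proof (induction A rule: finite_induct)
  case (insert p A)
  have IH: "periodic r (\<Prod>A) (\<lambda>n. \<forall>p\<in>A. S p n)"
    "card {n\<in>box r (\<Prod>A). \<forall>p\<in>A. S p n} = (\<Prod>p\<in>A. card {n\<in>box r p. S p n})"
    using insert by auto
  have p: "prime p" "periodic r p (S p)" using insert by auto
  have "coprime p (\<Prod>A)" using insert by (intro prod_coprime_right) (auto intro: primes_coprime)
  moreover have "p > 0" "\<Prod>A > 0" using insert by (auto intro!: prod_pos prime_gt_0_nat)
  ultimately have "card {n\<in>box r (p * \<Prod>A). S p n \<and> (\<forall>p\<in>A. S p n)} =
      card {n\<in>box r p. S p n} * card {n\<in>box r (\<Prod>A). \<forall>p\<in>A. S p n}"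
    using card_periodic_coprime p IH by blast
  moreover have "periodic r (p * \<Prod>A) (S p)" "periodic r (p * \<Prod>A) (\<lambda>n. \<forall>p\<in>A. S p n)"
    using p IH by (auto intro: periodic_dvd)
  then have "periodic r (p * \<Prod>A) (\<lambda>n. S p n \<and> (\<forall>p\<in>A. S p n))"
    unfolding periodic_def by metis
  ultimately show ?case using insert.hyps IH by simp
qed (auto simp: periodic_def)

lemma box_mono: "a \<le> b \<Longrightarrow> box r a \<subseteq> box r b"
  unfolding box_def by (intro PiE_mono) auto

text \<open>The box is squeezed between those of side \<open>B div q * q\<close> and
  \<open>(B div q + 1) * q\<close>, where the count is exact; the ratio of either side to
  \<open>B\<close> tends to 1.\<close>

lemma periodic_density:
  assumes "periodic r q S" "q > 0"
  shows "(\<lambda>B. real (card {n\<in>box r B. S n}) / real B ^ r)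
    \<longlonglongrightarrow> real (card {n\<in>box r q. S n}) / real q ^ r"
proof (rule tendsto_sandwich)
  let ?N = "real (card {n\<in>box r q. S n})"
  have lim: "(\<lambda>B. ?N * u B ^ r) \<longlonglongrightarrow> ?N / real q ^ r" if "u \<longlonglongrightarrow> 1 / real q" for u :: "nat \<Rightarrow> real"
  proof -
    have "(\<lambda>B. ?N * u B ^ r) \<longlonglongrightarrow> ?N * (1 / real q) ^ r" by (intro tendsto_intros that)
    then show ?thesis by (simp add: power_one_over)
  qed
  have inv: "(\<lambda>B. 1 / real B) \<longlonglongrightarrow> 0" by (rule lim_1_over_n)
  have div: "real (B div q) / real B = 1 / real q - (real (B mod q) / real q) * (1 / real B)"
    if "B > 0" for B
  proof -
    have "real B = real (B div q) * real q + real (B mod q)"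
      by (metis div_mult_mod_eq of_nat_add of_nat_mult)
    then have "real (B div q) = (real B - real (B mod q)) / real q"
      using assms(2) by (simp add: field_simps)
    then show ?thesis using that by (simp add: diff_divide_distrib)
  qed
  have "(\<lambda>B. (real (B mod q) / real q) * (1 / real B)) \<longlonglongrightarrow> 0"
  proof (rule tendsto_sandwich[OF _ _ tendsto_const inv])
    show "\<forall>\<^sub>F B in sequentially. (real (B mod q) / real q) * (1 / real B) \<le> 1 / real B"
    proof (intro always_eventually allI)
      fix B
      have "real (B mod q) / real q \<le> 1" using assms(2) by (simp add: less_imp_le)
      then have "(real (B mod q) / real q) * (1 / real B) \<le> 1 * (1 / real B)"
        by (intro mult_right_mono) auto
      then show "(real (B mod q) / real q) * (1 / real B) \<le> 1 / real B" by simp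
    qed
  qed auto
  then have "(\<lambda>B. 1 / real q - (real (B mod q) / real q) * (1 / real B)) \<longlonglongrightarrow> 1 / real q - 0"
    by (intro tendsto_intros)
  then have "(\<lambda>B. 1 / real q - (real (B mod q) / real q) * (1 / real B)) \<longlonglongrightarrow> 1 / real q"
    by simp
  moreover have "\<forall>\<^sub>F B in sequentially.
      1 / real q - (real (B mod q) / real q) * (1 / real B) = real (B div q) / real B"
    using eventually_gt_at_top[of 0] by eventually_elim (rule div[symmetric])
  ultimately have u: "(\<lambda>B. real (B div q) / real B) \<longlonglongrightarrow> 1 / real q"
    by (rule Lim_transform_eventually)
  then show "(\<lambda>B. ?N * (real (B div q) / real B) ^ r) \<longlonglongrightarrow> ?N / real q ^ r" by (rule lim)
  have "(\<lambda>B. real (B div q) / real B + 1 / real B) \<longlonglongrightarrow> 1 / real q + 0"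
    by (intro tendsto_add u inv)
  then show "(\<lambda>B. ?N * (real (B div q) / real B + 1 / real B) ^ r) \<longlonglongrightarrow> ?N / real q ^ r"
    by (intro lim) simp
  \<comment> \<open>This inequality and the next hold for every \<open>B\<close>; 0 is no exception,
    since division by 0 yields 0.\<close>
  show "\<forall>\<^sub>F B in sequentially.
      ?N * (real (B div q) / real B) ^ r \<le> real (card {n\<in>box r B. S n}) / real B ^ r"
  proof (intro always_eventually allI)
    fix B
    have "card {n\<in>box r (B div q * q). S n} \<le> card {n\<in>box r B. S n}"
      using box_mono[of "B div q * q" B r] by (intro card_mono) auto
    then have "(B div q) ^ r * card {n\<in>box r q. S n} \<le> card {n\<in>box r B. S n}"
      unfolding card_periodic_multiple[OF assms] .
    then have "real ((B div q) ^ r * card {n\<in>box r q. S n}) \<le> real (card {n\<in>box r B. S n})"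
      by (rule of_nat_mono)
    then show "?N * (real (B div q) / real B) ^ r \<le> real (card {n\<in>box r B. S n}) / real B ^ r"
      by (simp add: power_divide divide_right_mono mult.commute)
  qed
  show "\<forall>\<^sub>F B in sequentially.
      real (card {n\<in>box r B. S n}) / real B ^ r \<le> ?N * (real (B div q) / real B + 1 / real B) ^ r"
  proof (intro always_eventually allI)
    fix B
    have "B \<le> (B div q + 1) * q" using dividend_less_div_times[OF assms(2), of B] by simp
    then have "card {n\<in>box r B. S n} \<le> card {n\<in>box r ((B div q + 1) * q). S n}"
      using box_mono[of B "(B div q + 1) * q" r] by (intro card_mono) auto
    then have "card {n\<in>box r B. S n} \<le> (B div q + 1) ^ r * card {n\<in>box r q. S n}"
      unfolding card_periodic_multiple[OF assms] .
    then have "real (card {n\<in>box r B. S n}) \<le> real ((B div q + 1) ^ r * card {n\<in>box r q. S n})"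
      by (rule of_nat_mono)
    then have "real (card {n\<in>box r B. S n}) / real B ^ r \<le>
        real ((B div q + 1) ^ r * card {n\<in>box r q. S n}) / real B ^ r"
      by (rule divide_right_mono) simp
    also have "\<dots> = ?N * ((real (B div q) + 1) / real B) ^ r"
      by (simp add: power_divide mult.commute add.commute)
    finally show "real (card {n\<in>box r B. S n}) / real B ^ r \<le>
        ?N * (real (B div q) / real B + 1 / real B) ^ r"
      by (simp add: add_divide_distrib)
  qed
qed

section \<open>From the sieve by primes up to \<open>M\<close> to the full density\<close>

lemma eval_mpoly_cong_mod:
  fixes f :: "int mpoly"
  assumes "f \<in> mpolys r" "\<And>i. i < r \<Longrightarrow> [m i = n i] (mod q)"
  shows "[eval_mpoly f m = eval_mpoly f n] (mod q)"
  unfolding eval_mpoly_def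
proof (intro cong_sum cong_mult cong_refl cong_prod cong_pow)
  fix k i assume "k \<in> Poly_Mapping.keys f" "i \<in> Poly_Mapping.keys k"
  then have "i < r" using assms(1) unfolding mpolys_def by blast
  then show "[m i = n i] (mod q)" by (rule assms(2))
qed

theorem theorem1p5:
  fixes r s :: nat and P :: "nat \<Rightarrow> int mpoly"
  assumes "r \<ge> 1" and "s \<ge> 2"
    and "\<And>i. i < s \<Longrightarrow> P i \<in> mpolys r"
    and "\<And>i. i < s \<Longrightarrow> P i \<noteq> 0"
    and "coprime_mpolys r s P"
  shows "\<exists>L::real.
    (\<lambda>M::nat. \<Prod>p | prime p \<and> p \<le> M. 1 - real (num_common_zeros r s P p) / real p ^ r)
        \<longlonglongrightarrow> L \<and>
    has_density r (coprime_value_points r s P) L"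
proof -
  define S where "S p n \<longleftrightarrow> \<not> (\<forall>i<s. int p dvd eval_mpoly (P i) n)" for p n
  define t where "t p = 1 - real (num_common_zeros r s P p) / real p ^ r" for p
  define d where "d M = (\<Prod>p | prime p \<and> p \<le> M. t p)" for M
  define good where "good M B = {n\<in>box r B. \<forall>p\<in>{p. prime p \<and> p \<le> M}. S p n}" for M B
  define R where "R B = coprime_value_points r s P \<inter> box r B" for B
  define F where "F = P ` {..<s}"

  have zeros: "real (card {n\<in>box r p. S p n}) / real p ^ r = t p" if "p > 0" for p
  proof -
    let ?Z = "{n\<in>box r p. \<forall>i<s. [eval_mpoly (P i) n = 0] (mod int p)}"
    have "{n\<in>box r p. S p n} = box r p - ?Z" by (auto simp: S_def cong_0_iff)
    then have "card {n\<in>box r p. S p n} = p ^ r - card ?Z" "card ?Z \<le> p ^ r"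
      using card_mono[of "box r p" ?Z] by (auto simp: card_Diff_subset)
    then show ?thesis using that
      by (simp add: t_def num_common_zeros_def of_nat_diff diff_divide_distrib)
  qed
  have t: "0 \<le> t p" "t p \<le> 1" if "p > 0" for p
    by (simp flip: zeros[OF that], simp add: t_def)
  have d_nonneg: "d M \<ge> 0" for M
    unfolding d_def by (intro prod_nonneg) (auto intro: t prime_gt_0_nat)
  \<comment> \<open>The product converges because its factors lie between 0 and 1; its limit may be
    0.\<close>
  have "decseq d"
  proof (rule decseq_SucI)
    fix M
    show "d (Suc M) \<le> d M"
    proof (cases "prime (Suc M)")
      case True
      then have "{p. prime p \<and> p \<le> Suc M} = insert (Suc M) {p. prime p \<and> p \<le> M}"
        by (auto simp: le_Suc_eq)
      then have "d (Suc M) = t (Suc M) * d M" by (simp add: d_def)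
      then show ?thesis using t[of "Suc M"] d_nonneg[of M] by (simp add: mult_left_le_one_le)
    next
      case False
      then have "{p. prime p \<and> p \<le> Suc M} = {p. prime p \<and> p \<le> M}" by (auto simp: le_Suc_eq)
      then show ?thesis by (simp add: d_def)
    qed
  qed
  then obtain L where L: "d \<longlonglongrightarrow> L" using decseq_convergent[of d 0] d_nonneg by blast

  have good_lim: "(\<lambda>B. real (card (good M B)) / real B ^ r) \<longlonglongrightarrow> d M" for M
  proof -
    let ?A = "{p. prime p \<and> p \<le> M}"
    have per: "periodic r p (S p)" for p unfolding periodic_def
    proof (intro allI impI)
      fix m n assume *: "\<forall>i<r. [m i = n i] (mod int p)"
      have "int p dvd eval_mpoly (P i) m \<longleftrightarrow> int p dvd eval_mpoly (P i) n" if "i < s" for i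
        using eval_mpoly_cong_mod[of "P i" r m n "int p"] assms(3)[OF that] * cong_dvd_iff by blast
      then show "S p m = S p n" by (auto simp: S_def)
    qed
    have A: "periodic r (\<Prod>?A) (\<lambda>n. \<forall>p\<in>?A. S p n)"
      "card {n\<in>box r (\<Prod>?A). \<forall>p\<in>?A. S p n} = (\<Prod>p\<in>?A. card {n\<in>box r p. S p n})"
    proof -
      have "finite ?A" "\<And>p. p \<in> ?A \<Longrightarrow> prime p" by auto
      from card_periodic_primes[OF this per]
      show "periodic r (\<Prod>?A) (\<lambda>n. \<forall>p\<in>?A. S p n)"
        "card {n\<in>box r (\<Prod>?A). \<forall>p\<in>?A. S p n} = (\<Prod>p\<in>?A. card {n\<in>box r p. S p n})"
        by blast+
    qed
    have "\<Prod>?A > 0" by (intro prod_pos) (auto intro: prime_gt_0_nat)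
    then have "(\<lambda>B. real (card (good M B)) / real B ^ r) \<longlonglongrightarrow>
        real (card {n\<in>box r (\<Prod>?A). \<forall>p\<in>?A. S p n}) / real (\<Prod>?A) ^ r"
      unfolding good_def by (rule periodic_density[OF A(1)])
    also have "real (card {n\<in>box r (\<Prod>?A). \<forall>p\<in>?A. S p n}) / real (\<Prod>?A) ^ r =
        (\<Prod>p\<in>?A. real (card {n\<in>box r p. S p n}) / real p ^ r)"
      unfolding A(2) by (simp add: prod_dividef prod_power_distrib)
    also have "\<dots> = d M" unfolding d_def by (intro prod.cong) (auto intro: zeros prime_gt_0_nat)
    finally show ?thesis .
  qed
  have F: "finite F" "F \<subseteq> mpolys r" "coprime_family r F"
    using assms coprime_family_of_coprime_mpolys[of r s P 0] by (auto simp: F_def)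
  obtain C K where C: "C \<ge> 0" and bad: "\<And>M B. M \<ge> K \<Longrightarrow> B \<ge> K \<Longrightarrow>
      real (card (bad_points r F M B)) \<le> C * real B ^ r * (1 / real M + 1 / real B)"
    using card_bad_points[OF F] by blast
  have R_good: "R B \<subseteq> good M B" for M B
  proof
    fix n assume n: "n \<in> R B"
    then have Gcd: "Gcd ((\<lambda>i. eval_mpoly (P i) n) ` {..<s}) = 1"
      by (auto simp: R_def coprime_value_points_def)
    have "S p n" if "prime p" for p
    proof (rule ccontr)
      assume "\<not> S p n"
      then have "int p dvd Gcd ((\<lambda>i. eval_mpoly (P i) n) ` {..<s})"
        by (intro Gcd_greatest) (auto simp: S_def)
      then show False using Gcd that by auto
    qed
    then show "n \<in> good M B" using n by (auto simp: good_def R_def)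
  qed
  have good_R: "good M B \<subseteq> R B \<union> bad_points r F M B" for M B
  proof
    fix n assume n: "n \<in> good M B"
    then have box: "n \<in> box r B" by (simp add: good_def)
    let ?G = "Gcd ((\<lambda>i. eval_mpoly (P i) n) ` {..<s})"
    show "n \<in> R B \<union> bad_points r F M B"
    proof (cases "?G = 1")
      case True
      then show ?thesis using box
        by (auto simp: R_def coprime_value_points_def int_points_def box_def PiE_iff)
    next
      case False
      have "?G \<ge> 0" by simp
      \<comment> \<open>\<open>?G\<close> may also be 0, when all values vanish. Every prime divides
        it then, and \<open>prime_factor_nat\<close> excludes only 1.\<close>
      then have "nat ?G \<noteq> 1" using False by linarith
      then obtain p where p: "prime p" "p dvd nat ?G" using prime_factor_nat by blast
      have "int (nat ?G) = ?G" using \<open>?G \<ge> 0\<close> by (rule nat_0_le)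
      then have "int p dvd ?G" using p by (metis of_nat_dvd_iff)
      then have all: "int p dvd eval_mpoly (P i) n" if "i < s" for i
        using that Gcd_dvd[of "eval_mpoly (P i) n"] by (meson dvd_trans imageI lessThan_iff)
      then have "\<not> S p n" by (simp add: S_def)
      then have "p > M" using n p by (auto simp: good_def not_le)
      then show ?thesis using box p all by (auto simp: bad_points_def F_def)
    qed
  qed
  have fin: "finite (R B)" "finite (good M B)" for M B by (simp_all add: R_def good_def)
  have dist_R: "\<bar>real (card (R B)) / real B ^ r - real (card (good M B)) / real B ^ r\<bar>
      \<le> C * (1 / real M) + C * (1 / real B)" if "M \<ge> K" "B \<ge> K" "B > 0" for M B
  proof -
    have "card (R B) \<le> card (good M B)" using R_good fin by (intro card_mono)
    moreover have "card (good M B) \<le> card (R B) + card (bad_points r F M B)"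
      using card_mono[OF _ good_R[of M B]] card_Un_le[of "R B" "bad_points r F M B"] fin
      by (meson finite_UnI finite_bad_points le_trans)
    ultimately have "\<bar>real (card (R B)) - real (card (good M B))\<bar> \<le> real (card (bad_points r F M B))"
      by linarith
    also have "\<dots> \<le> C * real B ^ r * (1 / real M + 1 / real B)" using bad that by simp
    finally have "\<bar>real (card (R B)) - real (card (good M B))\<bar> / real B ^ r \<le>
        C * real B ^ r * (1 / real M + 1 / real B) / real B ^ r"
      by (rule divide_right_mono) simp
    then show ?thesis using that by (simp add: abs_divide diff_divide_distrib[symmetric] distrib_left add_divide_distrib)
  qed
  have small: "(\<lambda>B. C * (1 / real B)) \<longlonglongrightarrow> 0"
    using tendsto_mult[OF tendsto_const lim_1_over_n, of C] by simp
  have "(\<lambda>B. real (card (R B)) / real B ^ r) \<longlonglongrightarrow> L"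
  proof (rule LIMSEQ_I)
    fix e :: real assume "e > 0"
    \<comment> \<open>Four errors are kept below \<open>e / 4\<close>: the distance from
      \<open>d M\<close> to \<open>L\<close>, the tails \<open>C / M\<close> and
      \<open>C / B\<close>, and the distance of the frequency of \<open>good M B\<close> from
      \<open>d M\<close>. \<open>M\<close> is chosen first, and \<open>B0\<close> depends on
      it.\<close>
    then have e: "e / 4 > 0" by simp
    have small': "\<forall>\<^sub>F M in sequentially. \<bar>C * (1 / real M)\<bar> < e / 4"
      using tendstoD[OF small e] by (simp only: dist_real_def diff_zero)
    have "\<forall>\<^sub>F M in sequentially. \<bar>d M - L\<bar> < e / 4"
      using tendstoD[OF L e] by (simp only: dist_real_def)
    from eventually_happens[OF eventually_conj[OF this eventually_conj[OF small' eventually_ge_at_top[of K]]]]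
     obtain M where M: "\<bar>d M - L\<bar> < e / 4" "\<bar>C * (1 / real M)\<bar> < e / 4" "M \<ge> K"
      by auto
    have "\<forall>\<^sub>F B in sequentially. \<bar>real (card (good M B)) / real B ^ r - d M\<bar> < e / 4 \<and>
        \<bar>C * (1 / real B)\<bar> < e / 4 \<and> B \<ge> max K 1"
      by (intro eventually_conj small' eventually_ge_at_top)
        (use tendstoD[OF good_lim e] in \<open>simp only: dist_real_def\<close>)
    then obtain B0 where B0: "\<And>B. B \<ge> B0 \<Longrightarrow>
        \<bar>real (card (good M B)) / real B ^ r - d M\<bar> < e / 4 \<and>
        \<bar>C * (1 / real B)\<bar> < e / 4 \<and> B \<ge> max K 1"
      unfolding eventually_at_top_linorder by blast
    have "\<bar>real (card (R B)) / real B ^ r - L\<bar> < e" if "B \<ge> B0" for B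
    proof -
      have "B \<ge> K" "B > 0" using B0[OF that] by auto
      note * = dist_R[OF M(3) this]
      have "x < e" if "x = \<bar>u - L\<bar>" "\<bar>u - g\<bar> \<le> c1 + c2" "\<bar>g - d M\<bar> < e / 4" "\<bar>c2\<bar> < e / 4"
        "\<bar>c1\<bar> < e / 4" for x u g c1 c2
        using that M(1) by linarith
      from this[OF refl *] B0[OF that] M(2) show ?thesis by blast
    qed
    then show "\<exists>B0. \<forall>B\<ge>B0. norm (real (card (R B)) / real B ^ r - L) < e"
      by (auto simp: real_norm_def)
  qed
  then have "has_density r (coprime_value_points r s P) L"
    by (simp add: has_density_def R_def)
  then show ?thesis using L unfolding d_def t_def by blast
qed

end
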